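(* Let $N$ be a compact manifold with boundary $\partial N$, let $M=N\cup_{\partial N}\overline N$ be its double with the obvious reflection $\phi$, $G=\{\mathrm{id},\phi\}$, and let $(f,g)$ be a stably Morse-Smale pair on $M$ consisting of a $G$-equivariant Morse function and a $G$-equivariant metric. Let $(\check{\mathbb C},\check{\mathbb D})$ be the chain complex with $\check{\mathbb C}=C^o\oplus C^s\oplus C^u[-1]\oplus C^u_-$ and $$\check{\mathbb D}=\begin{bmatrix} \partial_o^o & 0 & 0 & \partial_o^u\\ \partial_s^o & \bar\partial_s^s & \bar \partial_s^u & \partial_s^u \\ 0 & \bar \partial_u^s & \bar \partial_u^u & \Pi_- \\ -\bar \partial_u^s \partial_s^o & 0 & 0 & -\bar \partial_u^u - \bar \partial_u^s \partial_s^u \end{bmatrix},$$ let $(\bar C,\bar\partial)$ be its subcomplex $\bar C=C^s\oplus C^u[-1]$, $\bar\partial=\begin{bmatrix}\bar\partial^s_s&\bar\partial^u_s\\ \bar\partial^s_u&\bar\partial^u_u\end{bmatrix}$, and let $(\hat{\mathbb C},\hat{\mathbb D})=(\check{\mathbb C},\check{\mathbb D})/(\bar C,\bar\partial)$ be the quotient complex. Let $(\check C,\check\partial)$ and $(\hat C,\hat\partial)$ be the Kronheimer–Mrowka complexes $$\check C=C^o\oplus C^s,\quad \check\partial=\begin{bmatrix}\partial_o^o&-\partial_o^u\bar\partial_u^s\\ \partial_s^o&\bar\partial_s^s-\partial_s^u\bar\partial_u^s\end{bmatrix};\qquad \hat C=C^o\oplus C^u,\quad \hat\partial=\begin{bmatrix}\partial_o^o&\partial_o^u\\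 -\bar\partial_u^s\partial_s^o&-\bar\partial_u^u-\bar\partial_u^s\partial_s^u\end{bmatrix}.$$ Then $(\check{\mathbb C},\check{\mathbb D})$ is quasi-isomorphic to $(\check C,\check\partial)$, and $(\hat{\mathbb C},\hat{\mathbb D})$ is quasi-isomorphic to $(\hat C,\hat\partial)$.
   Context: Basic notions. Equivariant functions and metrics are $G$-invariant ones; $M^G=\partial N$. Trajectories are solutions of $\dot\gamma+\operatorname{grad}_{f,g}(\gamma)=0$. $\mathscr D_{\mathsf p}$ and $\mathscr A_{\mathsf p}$ are the sets of points of $M$ flowing to the critical point $\mathsf p$ as $t\to-\infty$, respectively $t\to+\infty$. Submanifolds $X,Y$ intersect cleanly if $X\cap Y$ is a submanifold with $T_z(X\cap Y)=T_zX\cap T_zY$ for all $z\in X\cap Y$. $(f,g)$ is stably Morse-Smale if for all critical points $\mathsf p,\mathsf q$ of $f$, $\mathscr D_{\mathsf p}$ and $\mathscr A_{\mathsf q}$ intersect cleanly and $T_z\mathscr D_{\mathsf p}+T_z\mathscr A_{\mathsf q}\supset T_zM^{\mathrm{stab}(z)}$ for all $z\in\mathscr D_{\mathsf p}\cap\mathscr A_{\mathsf q}$, where $\mathrm{stab}(z)\subset G$ is the stabilizer and $M^H$ is the fixed set of a subgroup $H$. Critical points. Write $f_N=f|_N$, $f_{\partial N}=f|_{\partial N}$. $\mathrm{Crit}^o$ is the set of critical points of $f_N$ in the interior of $N$; $\mathrm{Crit}^s$ (stable) and $\mathrm{Crit}^u$ (unstable) are the sets of critical points in $\partial N$ at which the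 Hessian of $f$ is positive, respectively negative, on the line normal to $\partial N$. $\mathrm{ind}_{f_N}$ is the Morse index (of $f$ on $M$); the index of $f_{\partial N}$ at a boundary critical point equals $\mathrm{ind}_{f_N}$ if stable and $\mathrm{ind}_{f_N}-1$ if unstable. Chain groups. Let $R$ be a commutative ring. $C^\dagger$ ($\dagger\in\{o,s,u\}$) is the free $R$-module on $\mathrm{Crit}^\dagger$, graded by $\mathrm{ind}_{f_N}$; $C^u[-1]$ is $C^u$ graded by $\mathrm{ind}_{f_N}-1$; $C^u_-$ is a copy of $C^u$ (graded by $\mathrm{ind}_{f_N}$) with generators $\mathsf p_-$, $\mathsf p\in\mathrm{Crit}^u$. Entry $(i,j)$ of a matrix maps the $j$-th summand to the $i$-th, identifying $C^u_-$ with $C^u$ where needed. It is known (and may be assumed) that all the differentials above square to zero. Orientations. Orient the descending manifolds $\mathscr D_{\mathsf p}\cap\partial N$ of $(f,g)|_{\partial N}$. Orient $\mathscr D_{\mathsf p}$ arbitrarily if $\mathsf p\in\mathrm{Crit}^o$; if $\mathsf p\in\mathrm{Crit}^s$ (so $\mathscr D_{\mathsf p}\subset\partial N$), use the orientation chosen in $\partial N$; if $\mathsf p\in\mathrm{Crit}^u$, orient so that $T_{\mathsf p}\mathscr D_{\mathsf p}\simeq\mathbb R\langle\mathfrak o_{\mathsf p}\rangle\oplus T_{\mathsf p}(\mathscr D_{\mathsf p}\cap\partial N)$ preserves orientation, $\mathfrak o_{\mathsf p}$ being the outward-pointing normal to $\partial N$. A rigid trajectory $\gamma$ from $\mathsf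 p$ to $\mathsf q$ gets the sign $\boldsymbol o(\gamma)\in\{\pm1\}$ for which $T_{\mathsf p}\mathscr D_{\mathsf p}\simeq\boldsymbol o(\gamma)\,\mathbb R\langle\partial_t\rangle\oplus T_{\mathsf q}\mathscr D_{\mathsf q}$, induced by the linearized negative gradient flow, is orientation preserving (concretely: along $\gamma$, $T\mathscr D_{\mathsf p}/\mathbb R\dot\gamma\simeq TM/T\mathscr A_{\mathsf q}$, identified with $T_{\mathsf q}M/T_{\mathsf q}\mathscr A_{\mathsf q}\simeq T_{\mathsf q}\mathscr D_{\mathsf q}$); for trajectories counted in $\partial N$, the same is done inside $\partial N$ with the descending manifolds in $\partial N$. Maps. For $(\star,\dagger)\in\{(o,o),(o,s),(u,o),(u,s)\}$, $\partial^\star_\dagger:C^\star\to C^\dagger$ is the signed count of trajectories in $N$, modulo translation, from $\mathsf p\in\mathrm{Crit}^\star$ to $\mathsf q\in\mathrm{Crit}^\dagger$ with $\mathrm{ind}_{f_N}(\mathsf p)-\mathrm{ind}_{f_N}(\mathsf q)=1$. For $\star,\dagger\in\{s,u\}$, $\bar\partial^\star_\dagger:C^\star\to C^\dagger$ is the signed count of trajectories in $\partial N$, modulo translation, from $\mathsf p\in\mathrm{Crit}^\star$ to $\mathsf q\in\mathrm{Crit}^\dagger$ whose indices with respect to $f_{\partial N}$ differ by $1$. $\Pi_-:C^u_-\to C^u[-1]$ maps $\mathsf p_-\mapsto\mathsf p$. *)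

theory Defs
  imports
    "HOL-Analysis.Analysis"
    "HOL-Algebra.Module"
    "HOL-Algebra.AbelCoset"
    "HOL-Library.Function_Algebras"
    "Jordan_Normal_Form.Determinant"
begin

section \<open>Smooth manifolds\<close>

primrec Ck_on :: "nat \<Rightarrow> 'a::real_normed_vector set \<Rightarrow> ('a \<Rightarrow> 'b::real_normed_vector) \<Rightarrow> bool" where
  "Ck_on 0 S f \<longleftrightarrow> continuous_on S f"
| "Ck_on (Suc k) S f \<longleftrightarrow>
     (\<forall>x\<in>S. f differentiable (at x)) \<and> (\<forall>v. Ck_on k S (\<lambda>x. frechet_derivative f (at x) v))"

text \<open>Only used for open \<open>S\<close> and finite-dimensional domains.\<close>

definition smooth_on :: "'a::real_normed_vector set \<Rightarrow> ('a \<Rightarrow> 'b::real_normed_vector) \<Rightarrow> bool" where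
  "smooth_on S f \<longleftrightarrow> (\<forall>k. Ck_on k S f)"

type_synonym ('m, 'e) chart = "'m set \<times> ('m \<Rightarrow> 'e)"

definition chart_inv :: "('m, 'e) chart \<Rightarrow> 'e \<Rightarrow> 'm" where
  "chart_inv c = inv_into (fst c) (snd c)"

definition is_chart :: "('m::topological_space, 'e::real_normed_vector) chart \<Rightarrow> bool" where
  "is_chart c \<longleftrightarrow> open (fst c) \<and> open (snd c ` fst c) \<and>
     homeomorphism (fst c) (snd c ` fst c) (snd c) (chart_inv c)"

definition compatible :: "('m, 'e::real_normed_vector) chart \<Rightarrow> ('m, 'e) chart \<Rightarrow> bool" where
  "compatible c d \<longleftrightarrow>
     smooth_on (snd c ` (fst c \<inter> fst d)) (snd d \<circ> chart_inv c) \<and>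
     smooth_on (snd d ` (fst c \<inter> fst d)) (snd c \<circ> chart_inv d)"

text \<open>
  The manifold is the whole type \<open>'m\<close>. The model space \<open>'e\<close> is only required to be
  finite-dimensional, so that it may be the zero space. Second countability follows from
  compactness.
\<close>

definition closed_manifold :: "('m::t2_space, 'e::real_normed_vector) chart set \<Rightarrow> bool" where
  "closed_manifold A \<longleftrightarrow>
     compact (UNIV :: 'm set) \<and> (\<exists>B :: 'e set. finite B \<and> span B = UNIV) \<and>
     (\<forall>c\<in>A. is_chart c) \<and> (\<Union>c\<in>A. fst c) = UNIV \<and> (\<forall>c\<in>A. \<forall>d\<in>A. compatible c d)"

definition smooth_chart :: "('m::topological_space, 'e::real_normed_vector) chart set \<Rightarrow>
    ('m, 'e) chart \<Rightarrow> bool" where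
  "smooth_chart A c \<longleftrightarrow> is_chart c \<and> (\<forall>d\<in>A. compatible c d)"

text \<open>
  Every point \<open>p\<close> has a preferred chart, through which the tangent space at \<open>p\<close> is identified
  with \<open>'e\<close>. Tangent vectors at \<open>p\<close>, bilinear forms on the tangent space, derivatives etc. are
  all expressed in this way. Conditions relating the tangent spaces at different points have to
  pass to a fixed chart first: \<open>to_chart A c p\<close> sends a tangent vector at \<open>p\<close> to its coordinates
  in \<open>c\<close>, and \<open>from_chart A c p\<close> goes back.
\<close>

definition chart_at :: "('m, 'e) chart set \<Rightarrow> 'm \<Rightarrow> ('m, 'e) chart" where
  "chart_at A p = (SOME c. c \<in> A \<and> p \<in> fst c)"

definition to_chart :: "('m, 'e::real_normed_vector) chart set \<Rightarrow> ('m, 'e) chart \<Rightarrow> 'm \<Rightarrow> 'e \<Rightarrow> 'e" where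
  "to_chart A c p = frechet_derivative (snd c \<circ> chart_inv (chart_at A p)) (at (snd (chart_at A p) p))"

definition from_chart :: "('m, 'e::real_normed_vector) chart set \<Rightarrow> ('m, 'e) chart \<Rightarrow> 'm \<Rightarrow> 'e \<Rightarrow> 'e" where
  "from_chart A c p = frechet_derivative (snd (chart_at A p) \<circ> chart_inv c) (at (snd c p))"

definition smooth_map :: "('m::topological_space, 'e::real_normed_vector) chart set \<Rightarrow> ('m \<Rightarrow> 'm) \<Rightarrow> bool" where
  "smooth_map A h \<longleftrightarrow> continuous_on UNIV h \<and>
     (\<forall>c\<in>A. \<forall>d\<in>A. smooth_on (snd c ` (fst c \<inter> h -` fst d)) (snd d \<circ> h \<circ> chart_inv c))"

definition map_deriv :: "('m, 'e::real_normed_vector) chart set \<Rightarrow> ('m \<Rightarrow> 'm) \<Rightarrow> 'm \<Rightarrow> 'e \<Rightarrow> 'e" where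
  "map_deriv A h p =
     frechet_derivative (snd (chart_at A (h p)) \<circ> h \<circ> chart_inv (chart_at A p)) (at (snd (chart_at A p) p))"

definition smooth_fun :: "('m, 'e::real_normed_vector) chart set \<Rightarrow> ('m \<Rightarrow> real) \<Rightarrow> bool" where
  "smooth_fun A f \<longleftrightarrow> (\<forall>c\<in>A. smooth_on (snd c ` fst c) (f \<circ> chart_inv c))"

definition smooth_curve :: "('m::topological_space, 'e::real_normed_vector) chart set \<Rightarrow>
    real set \<Rightarrow> (real \<Rightarrow> 'm) \<Rightarrow> bool" where
  "smooth_curve A I \<gamma> \<longleftrightarrow> continuous_on I \<gamma> \<and>
     (\<forall>c\<in>A. smooth_on {t\<in>I. \<gamma> t \<in> fst c} (snd c \<circ> \<gamma>))"

definition has_velocity :: "('m, 'e::real_normed_vector) chart set \<Rightarrow> (real \<Rightarrow> 'm) \<Rightarrow> real \<Rightarrow> 'e \<Rightarrow> bool" where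
  "has_velocity A \<gamma> t v \<longleftrightarrow> ((snd (chart_at A (\<gamma> t)) \<circ> \<gamma>) has_vector_derivative v) (at t)"

text \<open>Submanifolds are embedded; their components may have different dimensions.\<close>

definition submanifold :: "('m::topological_space, 'e::real_normed_vector) chart set \<Rightarrow> 'm set \<Rightarrow> bool" where
  "submanifold A S \<longleftrightarrow>
     (\<forall>z\<in>S. \<exists>c V. smooth_chart A c \<and> z \<in> fst c \<and> subspace V \<and>
        snd c ` (fst c \<inter> S) = snd c ` fst c \<inter> {snd c z + v | v. v \<in> V})"

definition tangent :: "('m::topological_space, 'e::real_normed_vector) chart set \<Rightarrow> 'm set \<Rightarrow> 'm \<Rightarrow> 'e set" where
  "tangent A S z = {v. \<exists>\<gamma> \<epsilon>. \<epsilon> > 0 \<and> smooth_curve A {-\<epsilon><..<\<epsilon>} \<gamma> \<and> \<gamma> ` {-\<epsilon><..<\<epsilon>} \<subseteq> S \<and>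
     \<gamma> 0 = z \<and> has_velocity A \<gamma> 0 v}"

definition sumset :: "'e::plus set \<Rightarrow> 'e set \<Rightarrow> 'e set" where
  "sumset V W = {v + w | v w. v \<in> V \<and> w \<in> W}"

definition intersect_cleanly :: "('m::topological_space, 'e::real_normed_vector) chart set \<Rightarrow>
    'm set \<Rightarrow> 'm set \<Rightarrow> bool" where
  "intersect_cleanly A X Y \<longleftrightarrow> submanifold A (X \<inter> Y) \<and>
     (\<forall>z\<in>X \<inter> Y. tangent A (X \<inter> Y) z = tangent A X z \<inter> tangent A Y z)"

text \<open>
  \<open>N\<close> is a domain with smooth boundary, the boundary being the topological frontier.
  \<open>smooth_double A N \<phi>\<close>: the manifold is the double of \<open>N\<close>, with reflection \<open>\<phi>\<close>; here \<open>N\<close> is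
  identified with its image in the double, and \<open>\<phi> ` N\<close> is the second copy of \<open>N\<close>.
\<close>

definition smooth_domain :: "('m::topological_space, 'e::real_normed_vector) chart set \<Rightarrow> 'm set \<Rightarrow> bool" where
  "smooth_domain A N \<longleftrightarrow> closed N \<and>
     (\<forall>z\<in>frontier N. \<exists>c l. smooth_chart A c \<and> z \<in> fst c \<and>
        bounded_linear (l :: 'e \<Rightarrow> real) \<and> (\<exists>v. l v \<noteq> 0) \<and>
        snd c ` (fst c \<inter> N) = {y \<in> snd c ` fst c. l y \<ge> l (snd c z)})"

definition smooth_double :: "('m::topological_space, 'e::real_normed_vector) chart set \<Rightarrow>
    'm set \<Rightarrow> ('m \<Rightarrow> 'm) \<Rightarrow> bool" where
  "smooth_double A N \<phi> \<longleftrightarrow> smooth_domain A N \<and> smooth_map A \<phi> \<and> \<phi> \<circ> \<phi> = id \<and>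
     N \<union> \<phi> ` N = UNIV \<and> N \<inter> \<phi> ` N = frontier N \<and> (\<forall>z\<in>frontier N. \<phi> z = z)"

section \<open>Morse functions, metrics and gradient trajectories\<close>

definition differential :: "('m, 'e::real_normed_vector) chart set \<Rightarrow> ('m \<Rightarrow> real) \<Rightarrow> 'm \<Rightarrow> 'e \<Rightarrow> real" where
  "differential A f p = frechet_derivative (f \<circ> chart_inv (chart_at A p)) (at (snd (chart_at A p) p))"

definition crit :: "('m, 'e::real_normed_vector) chart set \<Rightarrow> ('m \<Rightarrow> real) \<Rightarrow> 'm set" where
  "crit A f = {p. \<forall>v. differential A f p v = 0}"

text \<open>Intrinsic only at critical points.\<close>

definition hessian :: "('m, 'e::real_normed_vector) chart set \<Rightarrow> ('m \<Rightarrow> real) \<Rightarrow> 'm \<Rightarrow> 'e \<Rightarrow> 'e \<Rightarrow> real" where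
  "hessian A f p u v =
     frechet_derivative (\<lambda>y. frechet_derivative (f \<circ> chart_inv (chart_at A p)) (at y) v)
       (at (snd (chart_at A p) p)) u"

definition morse_function :: "('m, 'e::real_normed_vector) chart set \<Rightarrow> ('m \<Rightarrow> real) \<Rightarrow> bool" where
  "morse_function A f \<longleftrightarrow> smooth_fun A f \<and>
     (\<forall>p\<in>crit A f. \<forall>u. u \<noteq> 0 \<longrightarrow> (\<exists>v. hessian A f p u v \<noteq> 0))"

definition form_index :: "('e::real_vector \<Rightarrow> 'e \<Rightarrow> real) \<Rightarrow> 'e set \<Rightarrow> nat" where
  "form_index b T = Max {dim V | V. subspace V \<and> V \<subseteq> T \<and> (\<forall>u\<in>V. u \<noteq> 0 \<longrightarrow> b u u < 0)}"

definition riemannian_metric :: "('m, 'e::real_normed_vector) chart set \<Rightarrow> ('m \<Rightarrow> 'e \<Rightarrow> 'e \<Rightarrow> real) \<Rightarrow> bool" where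
  "riemannian_metric A g \<longleftrightarrow>
     (\<forall>p. bilinear (g p) \<and> (\<forall>u v. g p u v = g p v u) \<and> (\<forall>u. u \<noteq> 0 \<longrightarrow> g p u u > 0)) \<and>
     (\<forall>c\<in>A. \<forall>u v. smooth_on (snd c ` fst c)
        (\<lambda>y. let q = chart_inv c y in g q (from_chart A c q u) (from_chart A c q v)))"

definition invariant_fun :: "('m \<Rightarrow> 'm) set \<Rightarrow> ('m \<Rightarrow> real) \<Rightarrow> bool" where
  "invariant_fun G f \<longleftrightarrow> (\<forall>h\<in>G. \<forall>p. f (h p) = f p)"

definition invariant_metric :: "('m, 'e::real_normed_vector) chart set \<Rightarrow> ('m \<Rightarrow> 'm) set \<Rightarrow>
    ('m \<Rightarrow> 'e \<Rightarrow> 'e \<Rightarrow> real) \<Rightarrow> bool" where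
  "invariant_metric A G g \<longleftrightarrow>
     (\<forall>h\<in>G. \<forall>p u v. g (h p) (map_deriv A h p u) (map_deriv A h p v) = g p u v)"

definition grad :: "('m, 'e::real_normed_vector) chart set \<Rightarrow> ('m \<Rightarrow> real) \<Rightarrow>
    ('m \<Rightarrow> 'e \<Rightarrow> 'e \<Rightarrow> real) \<Rightarrow> 'm \<Rightarrow> 'e" where
  "grad A f g p = (THE w. \<forall>v. g p w v = differential A f p v)"

definition trajectory :: "('m::topological_space, 'e::real_normed_vector) chart set \<Rightarrow> ('m \<Rightarrow> real) \<Rightarrow>
    ('m \<Rightarrow> 'e \<Rightarrow> 'e \<Rightarrow> real) \<Rightarrow> (real \<Rightarrow> 'm) \<Rightarrow> bool" where
  "trajectory A f g \<gamma> \<longleftrightarrow> continuous_on UNIV \<gamma> \<and> (\<forall>t. has_velocity A \<gamma> t (- grad A f g (\<gamma> t)))"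

definition descending :: "('m::topological_space, 'e::real_normed_vector) chart set \<Rightarrow> ('m \<Rightarrow> real) \<Rightarrow>
    ('m \<Rightarrow> 'e \<Rightarrow> 'e \<Rightarrow> real) \<Rightarrow> 'm \<Rightarrow> 'm set" where
  "descending A f g p = {z. \<exists>\<gamma>. trajectory A f g \<gamma> \<and> \<gamma> 0 = z \<and> (\<gamma> \<longlongrightarrow> p) at_bot}"

definition ascending :: "('m::topological_space, 'e::real_normed_vector) chart set \<Rightarrow> ('m \<Rightarrow> real) \<Rightarrow>
    ('m \<Rightarrow> 'e \<Rightarrow> 'e \<Rightarrow> real) \<Rightarrow> 'm \<Rightarrow> 'm set" where
  "ascending A f g p = {z. \<exists>\<gamma>. trajectory A f g \<gamma> \<and> \<gamma> 0 = z \<and> (\<gamma> \<longlongrightarrow> p) at_top}"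

definition stab :: "('m \<Rightarrow> 'm) set \<Rightarrow> 'm \<Rightarrow> ('m \<Rightarrow> 'm) set" where
  "stab G z = {h\<in>G. h z = z}"

definition fixed_set :: "('m \<Rightarrow> 'm) set \<Rightarrow> 'm set" where
  "fixed_set H = {z. \<forall>h\<in>H. h z = z}"

definition stably_morse_smale :: "('m::topological_space, 'e::real_normed_vector) chart set \<Rightarrow>
    ('m \<Rightarrow> 'm) set \<Rightarrow> ('m \<Rightarrow> real) \<Rightarrow> ('m \<Rightarrow> 'e \<Rightarrow> 'e \<Rightarrow> real) \<Rightarrow> bool" where
  "stably_morse_smale A G f g \<longleftrightarrow>
     (\<forall>p\<in>crit A f. \<forall>q\<in>crit A f.
        intersect_cleanly A (descending A f g p) (ascending A f g q) \<and>
        (\<forall>z\<in>descending A f g p \<inter> ascending A f g q.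
           tangent A (fixed_set (stab G z)) z \<subseteq>
             sumset (tangent A (descending A f g p) z) (tangent A (ascending A f g q) z)))"

section \<open>Orientations\<close>

definition ordered_basis :: "'e::real_vector set \<Rightarrow> 'e list \<Rightarrow> bool" where
  "ordered_basis V bs \<longleftrightarrow> distinct bs \<and> independent (set bs) \<and> span (set bs) = V"

text \<open>Determinant of the matrix expressing \<open>cs\<close> in terms of the ordered basis \<open>bs\<close>.\<close>

definition basis_change_det :: "'e::real_vector list \<Rightarrow> 'e list \<Rightarrow> real" where
  "basis_change_det bs cs = Determinant.det
     (Matrix.mat (length bs) (length bs) (\<lambda>(i, j). representation (set bs) (cs ! j) (bs ! i)))"

text \<open>
  An orientation assigns to each ordered basis a sign; the zero space, with the empty list as its
  only ordered basis, has two orientations. The value \<open>0\<close> elsewhere is a normalization.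
\<close>

definition is_orientation :: "'e::real_vector set \<Rightarrow> ('e list \<Rightarrow> real) \<Rightarrow> bool" where
  "is_orientation V \<Omega> \<longleftrightarrow>
     (\<forall>bs. ordered_basis V bs \<longrightarrow> \<Omega> bs \<in> {1, -1}) \<and>
     (\<forall>bs cs. ordered_basis V bs \<and> ordered_basis V cs \<longrightarrow> \<Omega> cs = sgn (basis_change_det bs cs) * \<Omega> bs) \<and>
     (\<forall>bs. \<not> ordered_basis V bs \<longrightarrow> \<Omega> bs = 0)"

text \<open>\<open>bs\<close> maps to an ordered basis of \<open>T / V\<close>.\<close>

definition quotient_basis :: "'e::real_vector set \<Rightarrow> 'e set \<Rightarrow> 'e list \<Rightarrow> bool" where
  "quotient_basis T V bs \<longleftrightarrow> distinct bs \<and> independent (set bs) \<and> set bs \<subseteq> T \<and>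
     span (set bs) \<inter> V = {0} \<and> sumset (span (set bs)) V = T"

definition cont_frame_along :: "('m, 'e::real_normed_vector) chart set \<Rightarrow> real set \<Rightarrow> (real \<Rightarrow> 'm) \<Rightarrow>
    nat \<Rightarrow> (real \<Rightarrow> 'e list) \<Rightarrow> bool" where
  "cont_frame_along A I \<gamma> k X \<longleftrightarrow>
     (\<forall>t\<in>I. length (X t) = k) \<and>
     (\<forall>c\<in>A. \<forall>t\<in>I. \<gamma> t \<in> fst c \<longrightarrow>
        (\<forall>i<k. continuous (at t within I) (\<lambda>s. to_chart A c (\<gamma> s) (X s ! i))))"

definition frame_tendsto :: "('m, 'e::real_normed_vector) chart set \<Rightarrow> (real \<Rightarrow> 'm) \<Rightarrow>
    (real \<Rightarrow> 'e list) \<Rightarrow> 'm \<Rightarrow> 'e list \<Rightarrow> real filter \<Rightarrow> bool" where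
  "frame_tendsto A \<gamma> X p x F \<longleftrightarrow>
     (\<forall>i<length x. ((\<lambda>s. to_chart A (chart_at A p) (\<gamma> s) (X s ! i)) \<longlongrightarrow> x ! i) F)"

text \<open>
  \<open>trajectory_sign A f g W p q \<Omega>p \<Omega>q \<gamma> s\<close>: the trajectory \<open>\<gamma>\<close> from \<open>p\<close> to \<open>q\<close> in the invariant
  submanifold \<open>W\<close> has sign \<open>s\<close>, with respect to orientations \<open>\<Omega>p\<close>, \<open>\<Omega>q\<close> of the tangent spaces at
  \<open>p\<close>, \<open>q\<close> of the descending manifolds \<open>D p\<close>, \<open>D q\<close> in \<open>W\<close>. The frame \<open>Y\<close> of \<open>T (D p)\<close> transports
  the orientation of \<open>D p\<close> from \<open>p\<close> to \<open>\<gamma> 0\<close>; the frame \<open>Z\<close> of \<open>TW / T (Asc q)\<close> transports the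
  orientation of \<open>D q\<close> from \<open>q\<close> back to \<open>\<gamma> 0\<close>, using that at \<open>q\<close> this quotient is \<open>T (D q)\<close>. At
  \<open>\<gamma> 0\<close> the isomorphism of \<open>T (D p)\<close> modulo the velocity with \<open>TW / T (Asc q)\<close> lets one lift \<open>Z 0\<close>
  to \<open>X\<close>, and the velocity followed by \<open>X\<close> is compared with \<open>Y 0\<close>.
\<close>

definition trajectory_sign :: "('m::topological_space, 'e::real_normed_vector) chart set \<Rightarrow> ('m \<Rightarrow> real) \<Rightarrow>
    ('m \<Rightarrow> 'e \<Rightarrow> 'e \<Rightarrow> real) \<Rightarrow> 'm set \<Rightarrow> 'm \<Rightarrow> 'm \<Rightarrow> ('e list \<Rightarrow> real) \<Rightarrow> ('e list \<Rightarrow> real) \<Rightarrow>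
    (real \<Rightarrow> 'm) \<Rightarrow> real \<Rightarrow> bool" where
  "trajectory_sign A f g W p q \<Omega>p \<Omega>q \<gamma> s \<longleftrightarrow>
     (let Dp = descending A f g p \<inter> W; Dq = descending A f g q \<inter> W; Aq = ascending A f g q \<inter> W in
      \<exists>Y y Z z X.
        (\<forall>t\<le>0. ordered_basis (tangent A Dp (\<gamma> t)) (Y t)) \<and>
        ordered_basis (tangent A Dp p) y \<and>
        cont_frame_along A {..0} \<gamma> (length y) Y \<and> frame_tendsto A \<gamma> Y p y at_bot \<and>
        (\<forall>t\<ge>0. quotient_basis (tangent A W (\<gamma> t)) (tangent A Aq (\<gamma> t)) (Z t)) \<and>
        ordered_basis (tangent A Dq q) z \<and>
        cont_frame_along A {0..} \<gamma> (length z) Z \<and> frame_tendsto A \<gamma> Z q z at_top \<and>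
        ordered_basis (tangent A Dp (\<gamma> 0)) ((- grad A f g (\<gamma> 0)) # X) \<and>
        length X = length z \<and> (\<forall>i<length z. X ! i - Z 0 ! i \<in> tangent A Aq (\<gamma> 0)) \<and>
        s = \<Omega>p y * \<Omega>q z * sgn (basis_change_det (Y 0) ((- grad A f g (\<gamma> 0)) # X)))"

text \<open>Trajectories from \<open>p\<close> to \<open>q\<close> with image in \<open>K\<close>, modulo translation in time.\<close>

definition rigid_trajectories :: "('m::topological_space, 'e::real_normed_vector) chart set \<Rightarrow> ('m \<Rightarrow> real) \<Rightarrow>
    ('m \<Rightarrow> 'e \<Rightarrow> 'e \<Rightarrow> real) \<Rightarrow> 'm set \<Rightarrow> 'm \<Rightarrow> 'm \<Rightarrow> (real \<Rightarrow> 'm) set set" where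
  "rigid_trajectories A f g K p q =
     (\<lambda>\<gamma>. range (\<lambda>s t. \<gamma> (t + s))) `
       {\<gamma>. trajectory A f g \<gamma> \<and> range \<gamma> \<subseteq> K \<and> (\<gamma> \<longlongrightarrow> p) at_bot \<and> (\<gamma> \<longlongrightarrow> q) at_top}"

text \<open>
  The coefficient ring is a type of sort \<open>{comm_ring, comm_monoid_mult}\<close>, which is
  \<open>comm_ring_1\<close> without the requirement \<open>0 \<noteq> 1\<close>.
\<close>

definition signed_count :: "('m::topological_space, 'e::real_normed_vector) chart set \<Rightarrow> ('m \<Rightarrow> real) \<Rightarrow>
    ('m \<Rightarrow> 'e \<Rightarrow> 'e \<Rightarrow> real) \<Rightarrow> 'm set \<Rightarrow> 'm set \<Rightarrow> 'm \<Rightarrow> 'm \<Rightarrow> ('e list \<Rightarrow> real) \<Rightarrow> ('e list \<Rightarrow> real) \<Rightarrow>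
    'r::{comm_ring, comm_monoid_mult}" where
  "signed_count A f g W K p q \<Omega>p \<Omega>q =
     (\<Sum>\<tau>\<in>rigid_trajectories A f g K p q.
        if (THE s. \<exists>\<gamma>\<in>\<tau>. trajectory_sign A f g W p q \<Omega>p \<Omega>q \<gamma> s) = 1 then 1 else - 1)"

section \<open>Chain complexes of modules\<close>

record ('r, 'a) chain_cx =
  chain :: "int \<Rightarrow> ('r, 'a) module"
  bdry :: "int \<Rightarrow> 'a \<Rightarrow> 'a"

definition lin_map :: "'r ring \<Rightarrow> ('r, 'a) module \<Rightarrow> ('r, 'b) module \<Rightarrow> ('a \<Rightarrow> 'b) \<Rightarrow> bool" where
  "lin_map R M M' h \<longleftrightarrow> h \<in> carrier M \<rightarrow> carrier M' \<and>
     (\<forall>x\<in>carrier M. \<forall>y\<in>carrier M. h (x \<oplus>\<^bsub>M\<^esub> y) = h x \<oplus>\<^bsub>M'\<^esub> h y) \<and>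
     (\<forall>r\<in>carrier R. \<forall>x\<in>carrier M. h (r \<odot>\<^bsub>M\<^esub> x) = r \<odot>\<^bsub>M'\<^esub> h x)"

definition chain_complex :: "'r ring \<Rightarrow> ('r, 'a) chain_cx \<Rightarrow> bool" where
  "chain_complex R X \<longleftrightarrow>
     (\<forall>k. module R (chain X k)) \<and>
     (\<forall>k. lin_map R (chain X k) (chain X (k - 1)) (bdry X k)) \<and>
     (\<forall>k. \<forall>x\<in>carrier (chain X k). bdry X (k - 1) (bdry X k x) = \<zero>\<^bsub>chain X (k - 2)\<^esub>)"

text \<open>The fields \<open>mult\<close> and \<open>one\<close> that the module record inherits from rings are not used.\<close>

definition quotient_module :: "('r, 'a) module \<Rightarrow> 'a set \<Rightarrow> ('r, 'a set) module" where
  "quotient_module M S =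
     \<lparr>carrier = a_rcosets\<^bsub>M\<^esub> S, monoid.mult = undefined, one = undefined, zero = S, add = set_add M,
      smult = (\<lambda>r H. \<Union>h\<in>H. S +>\<^bsub>M\<^esub> (r \<odot>\<^bsub>M\<^esub> h))\<rparr>"

definition quotient_complex :: "('r, 'a) chain_cx \<Rightarrow> ('r, 'a) chain_cx \<Rightarrow> ('r, 'a set) chain_cx" where
  "quotient_complex X Y =
     \<lparr>chain = (\<lambda>k. quotient_module (chain X k) (carrier (chain Y k))),
      bdry = (\<lambda>k H. \<Union>h\<in>H. carrier (chain Y (k - 1)) +>\<^bsub>chain X (k - 1)\<^esub> bdry X k h)\<rparr>"

definition cycles :: "('r, 'a) chain_cx \<Rightarrow> int \<Rightarrow> 'a set" where
  "cycles X k = {x \<in> carrier (chain X k). bdry X k x = \<zero>\<^bsub>chain X (k - 1)\<^esub>}"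

definition boundaries :: "('r, 'a) chain_cx \<Rightarrow> int \<Rightarrow> 'a set" where
  "boundaries X k = bdry X (k + 1) ` carrier (chain X (k + 1))"

definition homology :: "('r, 'a) chain_cx \<Rightarrow> int \<Rightarrow> ('r, 'a set) module" where
  "homology X k = quotient_module ((chain X k)\<lparr>carrier := cycles X k\<rparr>) (boundaries X k)"

definition chain_map :: "'r ring \<Rightarrow> ('r, 'a) chain_cx \<Rightarrow> ('r, 'b) chain_cx \<Rightarrow> (int \<Rightarrow> 'a \<Rightarrow> 'b) \<Rightarrow> bool" where
  "chain_map R X Y h \<longleftrightarrow>
     (\<forall>k. lin_map R (chain X k) (chain Y k) (h k)) \<and>
     (\<forall>k. \<forall>x\<in>carrier (chain X k). h (k - 1) (bdry X k x) = bdry Y k (h k x))"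

definition homology_map :: "('r, 'b) chain_cx \<Rightarrow> (int \<Rightarrow> 'a \<Rightarrow> 'b) \<Rightarrow> int \<Rightarrow> 'a set \<Rightarrow> 'b set" where
  "homology_map Y h k H = (\<Union>x\<in>H. boundaries Y k +>\<^bsub>chain Y k\<^esub> h k x)"

text \<open>
  \<open>X\<close> and \<open>Y\<close> are related by a single quasi-isomorphism, which is a particular case of being
  related by a zigzag of quasi-isomorphisms.
\<close>

definition quasi_isomorphic :: "'r ring \<Rightarrow> ('r, 'a) chain_cx \<Rightarrow> ('r, 'b) chain_cx \<Rightarrow> bool" where
  "quasi_isomorphic R X Y \<longleftrightarrow> chain_complex R X \<and> chain_complex R Y \<and>
     (\<exists>h. chain_map R X Y h \<and>
        (\<forall>k. bij_betw (homology_map Y h k) (carrier (homology X k)) (carrier (homology Y k))))"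

definition type_ring :: "'r::{comm_ring, comm_monoid_mult} ring" where
  "type_ring = \<lparr>carrier = UNIV, monoid.mult = (*), one = 1, zero = 0, add = (+)\<rparr>"

text \<open>Finitely supported functions: the free module on \<open>S\<close>.\<close>

definition free_on :: "'m set \<Rightarrow> ('m \<Rightarrow> 'r::zero) set" where
  "free_on S = {a. finite {p. a p \<noteq> 0} \<and> {p. a p \<noteq> 0} \<subseteq> S}"

definition lin_ext :: "('m \<Rightarrow> 'm \<Rightarrow> 'r) \<Rightarrow> ('m \<Rightarrow> 'r::{comm_ring, comm_monoid_mult}) \<Rightarrow> 'm \<Rightarrow> 'r" where
  "lin_ext n a = (\<lambda>q. \<Sum>p | a p \<noteq> 0. a p * n p q)"

definition scale :: "'r \<Rightarrow> ('m \<Rightarrow> 'r) \<Rightarrow> 'm \<Rightarrow> 'r::{comm_ring, comm_monoid_mult}" where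
  "scale r a = (\<lambda>p. r * a p)"

definition module2 :: "(('m \<Rightarrow> 'r) \<times> ('m \<Rightarrow> 'r)) set \<Rightarrow>
    ('r::{comm_ring, comm_monoid_mult}, ('m \<Rightarrow> 'r) \<times> ('m \<Rightarrow> 'r)) module" where
  "module2 C = \<lparr>carrier = C, monoid.mult = undefined, one = undefined, zero = 0, add = (+),
     smult = (\<lambda>r (a, b). (scale r a, scale r b))\<rparr>"

definition module4 :: "(('m \<Rightarrow> 'r) \<times> ('m \<Rightarrow> 'r) \<times> ('m \<Rightarrow> 'r) \<times> ('m \<Rightarrow> 'r)) set \<Rightarrow>
    ('r::{comm_ring, comm_monoid_mult}, ('m \<Rightarrow> 'r) \<times> ('m \<Rightarrow> 'r) \<times> ('m \<Rightarrow> 'r) \<times> ('m \<Rightarrow> 'r)) module" where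
  "module4 C = \<lparr>carrier = C, monoid.mult = undefined, one = undefined, zero = 0, add = (+),
     smult = (\<lambda>r (a, b, c, e). (scale r a, scale r b, scale r c, scale r e))\<rparr>"

section \<open>The complexes of a manifold with boundary\<close>

text \<open>
  The index of \<open>f\<close> restricted to the boundary is the index of the Hessian of \<open>f\<close> restricted to the
  tangent space of the boundary. Likewise, since gradients of invariant functions with respect to
  invariant metrics are tangent to the fixed set, trajectories (and descending manifolds) of the
  restricted pair are those of \<open>(f, g)\<close> contained in (intersected with) the boundary.

  The orientations are given by \<open>\<omega>\<close>: \<open>\<omega> p\<close> is an orientation of the tangent space at \<open>p\<close> of the
  descending manifold if \<open>p\<close> is an interior critical point, and of its intersection with the
  boundary if \<open>p\<close> is a boundary critical point. As descending manifolds are cells, this determines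
  an orientation everywhere.
\<close>

context
  fixes A :: "('m::t2_space, 'e::real_normed_vector) chart set"
    and N :: "'m set"
    and f :: "'m \<Rightarrow> real"
    and g :: "'m \<Rightarrow> 'e \<Rightarrow> 'e \<Rightarrow> real"
    and \<omega> :: "'m \<Rightarrow> 'e list \<Rightarrow> real"
begin

definition normal_line :: "'m \<Rightarrow> 'e set" where
  "normal_line p = {n. \<forall>u\<in>tangent A (frontier N) p. g p n u = 0}"

definition crit_o :: "'m set" where
  "crit_o = crit A f \<inter> interior N"

definition crit_s :: "'m set" where
  "crit_s = {p \<in> crit A f \<inter> frontier N. \<forall>n\<in>normal_line p. n \<noteq> 0 \<longrightarrow> hessian A f p n n > 0}"

definition crit_u :: "'m set" where
  "crit_u = {p \<in> crit A f \<inter> frontier N. \<forall>n\<in>normal_line p. n \<noteq> 0 \<longrightarrow> hessian A f p n n < 0}"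

definition ind :: "'m \<Rightarrow> nat" where
  "ind p = form_index (hessian A f p) UNIV"

definition ind_bdry :: "'m \<Rightarrow> nat" where
  "ind_bdry p = form_index (hessian A f p) (tangent A (frontier N) p)"

definition orientation_choice :: bool where
  "orientation_choice \<longleftrightarrow>
     (\<forall>p\<in>crit_o. is_orientation (tangent A (descending A f g p) p) (\<omega> p)) \<and>
     (\<forall>p\<in>crit_s \<union> crit_u. is_orientation (tangent A (descending A f g p \<inter> frontier N) p) (\<omega> p))"

definition outward_normal :: "'m \<Rightarrow> 'e" where
  "outward_normal p = (THE n. n \<in> normal_line p \<and> g p n n = 1 \<and>
     (\<exists>\<gamma> \<epsilon>. \<epsilon> > 0 \<and> smooth_curve A {-\<epsilon><..<\<epsilon>} \<gamma> \<and> \<gamma> 0 = p \<and> has_velocity A \<gamma> 0 n \<and>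
        (\<forall>t\<in>{0<..<\<epsilon>}. \<gamma> t \<notin> N)))"

text \<open>The induced orientation of the descending manifold in the double.\<close>

definition orient :: "'m \<Rightarrow> 'e list \<Rightarrow> real" where
  "orient p =
     (if p \<in> crit_u then
        (THE \<Omega>. is_orientation (tangent A (descending A f g p) p) \<Omega> \<and>
           (\<forall>bs. ordered_basis (tangent A (descending A f g p \<inter> frontier N) p) bs \<longrightarrow>
              \<Omega> (outward_normal p # bs) = \<omega> p bs))
      else \<omega> p)"

definition coeff :: "'m set \<Rightarrow> 'm set \<Rightarrow> 'm \<Rightarrow> 'm \<Rightarrow> 'r::{comm_ring, comm_monoid_mult}" where
  "coeff S T p q =
     (if p \<in> S \<and> q \<in> T \<and> ind p = ind q + 1
      then signed_count A f g UNIV N p q (orient p) (orient q) else 0)"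

definition coeff_bdry :: "'m set \<Rightarrow> 'm set \<Rightarrow> 'm \<Rightarrow> 'm \<Rightarrow> 'r::{comm_ring, comm_monoid_mult}" where
  "coeff_bdry S T p q =
     (if p \<in> S \<and> q \<in> T \<and> ind_bdry p = ind_bdry q + 1
      then signed_count A f g (frontier N) (frontier N) p q (\<omega> p) (\<omega> q) else 0)"

text \<open>
  In \<open>d_x_y\<close> and \<open>b_x_y\<close> the source is \<open>C\<^sup>x\<close> and the target is \<open>C\<^sup>y\<close>: these are
  \<open>\<partial>\<close> and \<open>\<partial>\<close> with a bar, with \<open>x\<close> as upper and \<open>y\<close> as lower index.
\<close>

definition d_o_o :: "('m \<Rightarrow> 'r) \<Rightarrow> 'm \<Rightarrow> 'r::{comm_ring, comm_monoid_mult}" where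
  "d_o_o = lin_ext (coeff crit_o crit_o)"

definition d_o_s :: "('m \<Rightarrow> 'r) \<Rightarrow> 'm \<Rightarrow> 'r::{comm_ring, comm_monoid_mult}" where
  "d_o_s = lin_ext (coeff crit_o crit_s)"

definition d_u_o :: "('m \<Rightarrow> 'r) \<Rightarrow> 'm \<Rightarrow> 'r::{comm_ring, comm_monoid_mult}" where
  "d_u_o = lin_ext (coeff crit_u crit_o)"

definition d_u_s :: "('m \<Rightarrow> 'r) \<Rightarrow> 'm \<Rightarrow> 'r::{comm_ring, comm_monoid_mult}" where
  "d_u_s = lin_ext (coeff crit_u crit_s)"

definition b_s_s :: "('m \<Rightarrow> 'r) \<Rightarrow> 'm \<Rightarrow> 'r::{comm_ring, comm_monoid_mult}" where
  "b_s_s = lin_ext (coeff_bdry crit_s crit_s)"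

definition b_s_u :: "('m \<Rightarrow> 'r) \<Rightarrow> 'm \<Rightarrow> 'r::{comm_ring, comm_monoid_mult}" where
  "b_s_u = lin_ext (coeff_bdry crit_s crit_u)"

definition b_u_s :: "('m \<Rightarrow> 'r) \<Rightarrow> 'm \<Rightarrow> 'r::{comm_ring, comm_monoid_mult}" where
  "b_u_s = lin_ext (coeff_bdry crit_u crit_s)"

definition b_u_u :: "('m \<Rightarrow> 'r) \<Rightarrow> 'm \<Rightarrow> 'r::{comm_ring, comm_monoid_mult}" where
  "b_u_u = lin_ext (coeff_bdry crit_u crit_u)"

text \<open>\<open>C\<^sup>u\<close> and its copy \<open>C\<^sup>u\<^sub>-\<close> are both modelled by functions on \<open>crit_u\<close>.\<close>

definition Pi_minus :: "('m \<Rightarrow> 'r) \<Rightarrow> 'm \<Rightarrow> 'r" where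
  "Pi_minus e = e"

definition C_o :: "int \<Rightarrow> ('m \<Rightarrow> 'r::zero) set" where
  "C_o k = free_on {p \<in> crit_o. int (ind p) = k}"

definition C_s :: "int \<Rightarrow> ('m \<Rightarrow> 'r::zero) set" where
  "C_s k = free_on {p \<in> crit_s. int (ind p) = k}"

definition C_u :: "int \<Rightarrow> ('m \<Rightarrow> 'r::zero) set" where
  "C_u k = free_on {p \<in> crit_u. int (ind p) = k}"

definition C_u_shift :: "int \<Rightarrow> ('m \<Rightarrow> 'r::zero) set" where
  "C_u_shift k = free_on {p \<in> crit_u. int (ind p) - 1 = k}"

definition D_check :: "('r::{comm_ring, comm_monoid_mult},
    ('m \<Rightarrow> 'r) \<times> ('m \<Rightarrow> 'r) \<times> ('m \<Rightarrow> 'r) \<times> ('m \<Rightarrow> 'r)) chain_cx" where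
  "D_check =
     \<lparr>chain = (\<lambda>k. module4 (C_o k \<times> C_s k \<times> C_u_shift k \<times> C_u k)),
      bdry = (\<lambda>k (a, b, c, e).
        (d_o_o a + d_u_o e,
         d_o_s a + b_s_s b + b_u_s c + d_u_s e,
         b_s_u b + b_u_u c + Pi_minus e,
         - b_s_u (d_o_s a) + (- b_u_u e - b_s_u (d_u_s e))))\<rparr>"

definition C_bar :: "('r::{comm_ring, comm_monoid_mult},
    ('m \<Rightarrow> 'r) \<times> ('m \<Rightarrow> 'r) \<times> ('m \<Rightarrow> 'r) \<times> ('m \<Rightarrow> 'r)) chain_cx" where
  "C_bar =
     \<lparr>chain = (\<lambda>k. module4 ({0} \<times> C_s k \<times> C_u_shift k \<times> {0})),
      bdry = (\<lambda>k (a, b, c, e). (0, b_s_s b + b_u_s c, b_s_u b + b_u_u c, 0))\<rparr>"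

definition D_hat :: "('r::{comm_ring, comm_monoid_mult},
    (('m \<Rightarrow> 'r) \<times> ('m \<Rightarrow> 'r) \<times> ('m \<Rightarrow> 'r) \<times> ('m \<Rightarrow> 'r)) set) chain_cx" where
  "D_hat = quotient_complex D_check C_bar"

definition KM_check :: "('r::{comm_ring, comm_monoid_mult}, ('m \<Rightarrow> 'r) \<times> ('m \<Rightarrow> 'r)) chain_cx" where
  "KM_check =
     \<lparr>chain = (\<lambda>k. module2 (C_o k \<times> C_s k)),
      bdry = (\<lambda>k (a, b).
        (d_o_o a - d_u_o (b_s_u b),
         d_o_s a + (b_s_s b - d_u_s (b_s_u b))))\<rparr>"

definition KM_hat :: "('r::{comm_ring, comm_monoid_mult}, ('m \<Rightarrow> 'r) \<times> ('m \<Rightarrow> 'r)) chain_cx" where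
  "KM_hat =
     \<lparr>chain = (\<lambda>k. module2 (C_o k \<times> C_u k)),
      bdry = (\<lambda>k (a, e).
        (d_o_o a + d_u_o e,
         - b_s_u (d_o_s a) + (- b_u_u e - b_s_u (d_u_s e))))\<rparr>"

end

end

theory Submission
  imports Defs
begin

text \<open>
  In the large complex the entry \<open>\<Pi>\<^sub>-\<close> is an isomorphism from the summand \<open>C\<^sup>u\<^sub>-\<close> onto
  \<open>C\<^sup>u[-1]\<close>. Cancelling these two summands (Gaussian elimination) leaves \<open>C\<^sup>o \<oplus> C\<^sup>s\<close> with the
  differential of the first Kronheimer--Mrowka complex, which is thus a deformation retract: the
  retraction subtracts from \<open>(a, b)\<close> the values of \<open>\<partial>\<^sup>u\<^sub>o\<close>, \<open>\<partial>\<^sup>u\<^sub>s\<close> on the \<open>C\<^sup>u[-1]\<close>-component,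
  and the homotopy is the inverse of \<open>\<Pi>\<^sub>-\<close>. The quotient by \<open>C\<^sup>s \<oplus> C\<^sup>u[-1]\<close> is isomorphic to the
  second one, a coset being determined by its components in \<open>C\<^sup>o\<close> and \<open>C\<^sup>u\<^sub>-\<close>. All the relations
  needed, including the fact that the maps respect the gradings, are components of the
  hypothesis that the large complex is a chain complex.
\<close>

section \<open>Transport of module and complex structure along surjections\<close>

text \<open>\<open>M'\<close> starts out as a bare record; every element of it is some
  \<open>h x\<close>, so the axioms of \<open>M\<close> can be pushed forward. Additivity makes the
  image of zero neutral but does not identify it with the zero field of \<open>M'\<close>, hence the
  hypothesis \<open>zero\<close>.\<close>

lemma lin_map_surj_module:
  assumes M: "module R M" and h: "lin_map R M M' h" and surj: "h ` carrier M = carrier M'"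
    and zero: "h \<zero>\<^bsub>M\<^esub> = \<zero>\<^bsub>M'\<^esub>"
  shows "module R M'"
proof -
  interpret module R M by (fact M)
  have add: "h x \<oplus>\<^bsub>M'\<^esub> h y = h (x \<oplus>\<^bsub>M\<^esub> y)" if "x \<in> carrier M" "y \<in> carrier M" for x y
    using h that by (simp add: lin_map_def)
  have smult: "r \<odot>\<^bsub>M'\<^esub> h x = h (r \<odot>\<^bsub>M\<^esub> x)" if "r \<in> carrier R" "x \<in> carrier M" for r x
    using h that by (simp add: lin_map_def)
  show ?thesis
  proof (rule moduleI)
    show "abelian_group M'"
    proof (rule abelian_groupI, unfold surj[symmetric] zero[symmetric])
      fix x assume "x \<in> h ` carrier M"
      then obtain u where "u \<in> carrier M" "x = h u" by blast
      then have "h (\<ominus>\<^bsub>M\<^esub> u) \<oplus>\<^bsub>M'\<^esub> x = h \<zero>\<^bsub>M\<^esub>" by (simp add: add M.l_neg)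
      then show "\<exists>y\<in>h ` carrier M. y \<oplus>\<^bsub>M'\<^esub> x = h \<zero>\<^bsub>M\<^esub>" using \<open>u \<in> carrier M\<close> by blast
    qed (auto simp: add M.a_ac)
  qed (unfold surj[symmetric], auto simp: add smult smult_l_distr smult_r_distr smult_assoc1 R.is_cring)
qed

text \<open>Each chain of \<open>Y\<close> is some \<open>h k x\<close>, and \<open>comm\<close>
  moves the differential back to \<open>X\<close>, where linearity and square zero are known. The
  Kronheimer-Mrowka complexes and the quotient are recognized as complexes in this way.\<close>

lemma chain_complex_surj_image:
  assumes X: "chain_complex R X" and h: "\<And>k. lin_map R (chain X k) (chain Y k) (h k)"
    and surj: "\<And>k. h k ` carrier (chain X k) = carrier (chain Y k)"
    and zero: "\<And>k. h k \<zero>\<^bsub>chain X k\<^esub> = \<zero>\<^bsub>chain Y k\<^esub>"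
    and comm: "\<And>k x. x \<in> carrier (chain X k) \<Longrightarrow> h (k - 1) (bdry X k x) = bdry Y k (h k x)"
  shows "chain_complex R Y"
proof -
  have bdry: "lin_map R (chain X k) (chain X (k - 1)) (bdry X k)" for k
    using X by (simp add: chain_complex_def)
  have sq: "bdry X (k - 1) (bdry X k x) = \<zero>\<^bsub>chain X (k - 2)\<^esub>" if "x \<in> carrier (chain X k)" for k x
    using X that by (simp add: chain_complex_def)
  have mod: "module R (chain X k)" for k
    using X by (simp add: chain_complex_def)
  have in_X: "bdry X k x \<in> carrier (chain X (k - 1))" if "x \<in> carrier (chain X k)" for k x
    using bdry[of k] that by (auto simp: lin_map_def)
  note comm' = comm[symmetric]
  have lin: "lin_map R (chain Y k) (chain Y (k - 1)) (bdry Y k)" for k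
  proof -
    interpret module R "chain X k" by (rule mod)
    have hadd: "h k x \<oplus>\<^bsub>chain Y k\<^esub> h k y = h k (x \<oplus>\<^bsub>chain X k\<^esub> y)"
      if "x \<in> carrier (chain X k)" "y \<in> carrier (chain X k)" for k x y
      using h that by (simp add: lin_map_def)
    have hsmult: "r \<odot>\<^bsub>chain Y k\<^esub> h k x = h k (r \<odot>\<^bsub>chain X k\<^esub> x)"
      if "r \<in> carrier R" "x \<in> carrier (chain X k)" for k r x
      using h that by (simp add: lin_map_def)
    show ?thesis
      using bdry[of k]
      unfolding lin_map_def surj[symmetric]
      by (auto simp: hadd hsmult comm' in_X)
  qed
  have sqY: "bdry Y (k - 1) (bdry Y k y) = \<zero>\<^bsub>chain Y (k - 2)\<^esub>" if y: "y \<in> carrier (chain Y k)" for k y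
  proof -
    obtain x where x: "x \<in> carrier (chain X k)" "y = h k x"
      using y[folded surj] by blast
    show ?thesis
      using comm[OF in_X[OF x(1)]] by (simp add: x comm' sq zero)
  qed
  show ?thesis
    unfolding chain_complex_def using lin sqY lin_map_surj_module[OF mod h surj zero] by blast
qed

section \<open>Boundaries, cosets and induced maps on homology\<close>

lemma lin_map_zero:
  assumes "module R M" "module R M'" "lin_map R M M' h"
  shows "h \<zero>\<^bsub>M\<^esub> = \<zero>\<^bsub>M'\<^esub>"
proof -
  interpret M: module R M by fact
  interpret M': module R M' by fact
  have "h \<zero>\<^bsub>M\<^esub> \<in> carrier M'"
    using assms(3) by (auto simp: lin_map_def)
  moreover have "h (\<zero>\<^bsub>M\<^esub> \<oplus>\<^bsub>M\<^esub> \<zero>\<^bsub>M\<^esub>) = h \<zero>\<^bsub>M\<^esub> \<oplus>\<^bsub>M'\<^esub> h \<zero>\<^bsub>M\<^esub>"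
    using assms(3) M.M.zero_closed unfolding lin_map_def by blast
  ultimately show ?thesis
    using M'.M.add.l_cancel_one[of "h \<zero>\<^bsub>M\<^esub>" "h \<zero>\<^bsub>M\<^esub>"] by simp
qed

lemma lin_map_image_subgroup:
  assumes "module R M" "module R M'" "lin_map R M M' h"
  shows "abelian_subgroup (h ` carrier M) M'"
proof -
  interpret M: module R M by fact
  interpret M': module R M' by fact
  have "group_hom (add_monoid M) (add_monoid M') h"
    using assms(3) M.M.a_group M'.M.a_group
    by (auto simp: group_hom_def group_hom_axioms_def hom_def lin_map_def)
  then have "subgroup (h ` carrier M) (add_monoid M')"
    using group_hom.img_is_subgroup by fastforce
  then show ?thesis
    by (intro abelian_subgroupI3 additive_subgroupI M'.M.abelian_group_axioms)
qed

lemma chain_complexD: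
  assumes "chain_complex R X"
  shows "module R (chain X k)" "lin_map R (chain X k) (chain X (k - 1)) (bdry X k)"
    "x \<in> carrier (chain X k) \<Longrightarrow> bdry X k x \<in> carrier (chain X (k - 1))"
    "x \<in> carrier (chain X k) \<Longrightarrow> bdry X (k - 1) (bdry X k x) = \<zero>\<^bsub>chain X (k - 2)\<^esub>"
  using assms by (auto simp: chain_complex_def lin_map_def)

lemma boundaries_subgroup:
  assumes "chain_complex R X"
  shows "abelian_subgroup (boundaries X k) (chain X k)"
  using lin_map_image_subgroup[OF chain_complexD(1)[OF assms] chain_complexD(1)[OF assms]
      chain_complexD(2)[OF assms], of "k + 1"]
  by (simp add: boundaries_def)

lemma (in abelian_subgroup) coset_eqI:
  assumes "h \<in> H" "x \<in> carrier G" "y = h \<oplus> x"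
  shows "H +> x = H +> y"
  using a_repr_independence[of y H x] assms a_subgroup by (auto simp: a_r_coset_def')

text \<open>Cosets are formed with the addition alone, so restricting the carrier to cycles changes
  only which representatives occur.\<close>

lemma carrier_homology:
  "carrier (homology X k) = (\<lambda>x. boundaries X k +>\<^bsub>chain X k\<^esub> x) ` cycles X k"
  by (auto simp: homology_def quotient_module_def A_RCOSETS_def' a_r_coset_def')

lemma chain_mapD:
  assumes "chain_map R X Y h"
  shows "lin_map R (chain X k) (chain Y k) (h k)"
    "x \<in> carrier (chain X k) \<Longrightarrow> h k x \<in> carrier (chain Y k)"
    "x \<in> carrier (chain X k) \<Longrightarrow> h (k - 1) (bdry X k x) = bdry Y k (h k x)"
  using assms by (auto simp: chain_map_def lin_map_def)

context
  fixes R :: "'r ring" and X :: "('r, 'a) chain_cx" and Y :: "('r, 'b) chain_cx" and h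
  assumes X: "chain_complex R X" and Y: "chain_complex R Y" and h: "chain_map R X Y h"
begin

lemma chain_map_cycles: "x \<in> cycles X k \<Longrightarrow> h k x \<in> cycles Y k"
  using lin_map_zero[OF chain_complexD(1)[OF X] chain_complexD(1)[OF Y] chain_mapD(1)[OF h], of "k - 1"]
    chain_mapD(3)[OF h, of x k]
  by (simp add: cycles_def chain_mapD(2)[OF h])

text \<open>The induced map is a union over all representatives. Two of them differ by some
  \<open>bdry X (k + 1) w\<close>, whose image is the boundary of \<open>h (k + 1) w\<close>, so the
  union collapses to one coset.\<close>

lemma homology_map_coset:
  assumes x: "x \<in> cycles X k"
  shows "homology_map Y h k (boundaries X k +>\<^bsub>chain X k\<^esub> x) = boundaries Y k +>\<^bsub>chain Y k\<^esub> h k x"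
proof -
  interpret BX: abelian_subgroup "boundaries X k" "chain X k" by (rule boundaries_subgroup[OF X])
  interpret BY: abelian_subgroup "boundaries Y k" "chain Y k" by (rule boundaries_subgroup[OF Y])
  have xX: "x \<in> carrier (chain X k)" using x by (simp add: cycles_def)
  have "boundaries Y k +>\<^bsub>chain Y k\<^esub> h k z = boundaries Y k +>\<^bsub>chain Y k\<^esub> h k x"
    if z: "z \<in> boundaries X k +>\<^bsub>chain X k\<^esub> x" for z
  proof -
    obtain b where b: "b \<in> boundaries X k" "z = b \<oplus>\<^bsub>chain X k\<^esub> x"
      using z by (auto simp: a_r_coset_def')
    then obtain w where w: "w \<in> carrier (chain X (k + 1))" "b = bdry X (k + 1) w"
      by (auto simp: boundaries_def)
    then have "h k b \<in> boundaries Y k"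
      using chain_mapD(2,3)[OF h w(1)] by (simp add: boundaries_def)
    moreover have "h k z = h k b \<oplus>\<^bsub>chain Y k\<^esub> h k x"
      using chain_mapD(1)[OF h, of k] xX b BX.a_subset by (auto simp: lin_map_def)
    ultimately show ?thesis
      using BY.coset_eqI[OF _ chain_mapD(2)[OF h xX]] by metis
  qed
  moreover have "x \<in> boundaries X k +>\<^bsub>chain X k\<^esub> x"
    using xX by (rule BX.a_rcos_self)
  ultimately show ?thesis
    unfolding homology_map_def by blast
qed

end

section \<open>A criterion for quasi-isomorphism\<close>

text \<open>\<open>p\<close> and \<open>i\<close> induce mutually inverse maps on homology. On
  cycles the term of a chain homotopy that applies \<open>H\<close> after the differential vanishes,
  so \<open>H\<close> enters only as a choice of bounding chain for
  \<open>x - i (p x)\<close>.\<close>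

lemma quasi_isomorphic_deformation_retract:
  assumes X: "chain_complex R X" and Y: "chain_complex R Y"
    and p: "chain_map R X Y p" and i: "chain_map R Y X i"
    and pi: "\<And>k y. y \<in> carrier (chain Y k) \<Longrightarrow> p k (i k y) = y"
    and H: "\<And>k x. x \<in> carrier (chain X k) \<Longrightarrow> H k x \<in> carrier (chain X (k + 1))"
    and homotopy: "\<And>k x. x \<in> cycles X k \<Longrightarrow> x = bdry X (k + 1) (H k x) \<oplus>\<^bsub>chain X k\<^esub> i k (p k x)"
  shows "quasi_isomorphic R X Y"
proof -
  have "bij_betw (homology_map Y p k) (carrier (homology X k)) (carrier (homology Y k))" for k
  proof (rule bij_betw_byWitness)
    have "boundaries X k +>\<^bsub>chain X k\<^esub> i k (p k x) = boundaries X k +>\<^bsub>chain X k\<^esub> x"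
      if x: "x \<in> cycles X k" for x
    proof (rule abelian_subgroup.coset_eqI[OF boundaries_subgroup[OF X]])
      show "bdry X (k + 1) (H k x) \<in> boundaries X k"
        using H[of x k] x by (simp add: boundaries_def cycles_def)
      show "i k (p k x) \<in> carrier (chain X k)"
        using chain_map_cycles[OF Y X i chain_map_cycles[OF X Y p x]] by (simp add: cycles_def)
      show "x = bdry X (k + 1) (H k x) \<oplus>\<^bsub>chain X k\<^esub> i k (p k x)"
        by (rule homotopy[OF x])
    qed
    then show "\<forall>x\<in>carrier (homology X k). homology_map X i k (homology_map Y p k x) = x"
      by (simp add: carrier_homology homology_map_coset[OF X Y p] homology_map_coset[OF Y X i]
        chain_map_cycles[OF X Y p])
    show "\<forall>y\<in>carrier (homology Y k). homology_map Y p k (homology_map X i k y) = y"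
      by (simp add: carrier_homology homology_map_coset[OF X Y p] homology_map_coset[OF Y X i]
        chain_map_cycles[OF Y X i] pi cycles_def[of Y])
    show "homology_map Y p k ` carrier (homology X k) \<subseteq> carrier (homology Y k)"
      by (auto simp: carrier_homology homology_map_coset[OF X Y p] chain_map_cycles[OF X Y p])
    show "homology_map X i k ` carrier (homology Y k) \<subseteq> carrier (homology X k)"
      by (auto simp: carrier_homology homology_map_coset[OF Y X i] chain_map_cycles[OF Y X i])
  qed
  then show ?thesis
    using X Y p by (auto simp: quasi_isomorphic_def)
qed

section \<open>Linear extension and finitely supported functions\<close>

text \<open>\<open>lin_ext\<close> sums over the support of its argument. Several arguments are
  compared by summing over one common finite set, where the additional terms vanish.\<close>

lemma lin_ext_eq_sum:
  assumes "finite S" "{p. a p \<noteq> 0} \<subseteq> S"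
  shows "lin_ext n a q = (\<Sum>p\<in>S. a p * n p q)"
  unfolding lin_ext_def by (rule sum.mono_neutral_left) (use assms in auto)

lemma lin_ext_0 [simp]: "lin_ext n 0 = 0"
  by (simp add: lin_ext_def fun_eq_iff)

text \<open>Sums over infinite sets are 0 by default, so additivity is stated for finite
  supports.\<close>

lemma lin_ext_add:
  assumes "finite {p. a p \<noteq> 0}" "finite {p. b p \<noteq> 0}"
  shows "lin_ext n (a + b) = lin_ext n a + lin_ext n b"
proof
  fix q
  let ?S = "{p. a p \<noteq> 0} \<union> {p. b p \<noteq> 0}"
  have "{p. (a + b) p \<noteq> 0} \<subseteq> ?S" by auto
  then show "lin_ext n (a + b) q = (lin_ext n a + lin_ext n b) q"
    using assms by (simp add: lin_ext_eq_sum[of ?S] distrib_right sum.distrib)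
qed

lemma lin_ext_uminus: "lin_ext n (- a) = - lin_ext n a"
  by (simp add: lin_ext_def fun_eq_iff sum_negf)

lemma lin_ext_scale:
  assumes "finite {p. a p \<noteq> 0}"
  shows "lin_ext n (scale r a) = scale r (lin_ext n a)"
proof
  fix q
  \<comment> \<open>The inclusion can be strict, since \<open>r\<close> may be zero or a zero
    divisor.\<close>
  have "{p. scale r a p \<noteq> 0} \<subseteq> {p. a p \<noteq> 0}" by (auto simp: scale_def)
  then show "lin_ext n (scale r a) q = scale r (lin_ext n a) q"
    using assms by (simp add: lin_ext_eq_sum[of "{p. a p \<noteq> 0}"] scale_def sum_distrib_left mult.assoc)
qed

lemma lin_ext_diff:
  assumes "finite {p. a p \<noteq> 0}" "finite {p. b p \<noteq> 0}"
  shows "lin_ext n (a - b) = lin_ext n a - lin_ext n b"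
  using lin_ext_add[of a "- b" n] assms by (simp add: lin_ext_uminus)

lemma free_on_0 [simp]: "0 \<in> free_on S"
  by (simp add: free_on_def)

lemma free_on_add:
  assumes "a \<in> free_on S" "b \<in> free_on S"
  shows "(a + b :: _ \<Rightarrow> 'r::comm_ring) \<in> free_on S"
proof -
  have "{p. (a + b) p \<noteq> 0} \<subseteq> {p. a p \<noteq> 0} \<union> {p. b p \<noteq> 0}" by auto
  from this finite_subset[OF this] show ?thesis
    using assms unfolding free_on_def by blast
qed

lemma free_on_uminus_iff [simp]: "(- a :: _ \<Rightarrow> 'r::comm_ring) \<in> free_on S \<longleftrightarrow> a \<in> free_on S"
  by (simp add: free_on_def)

lemma free_on_diff:
  assumes "a \<in> free_on S" "b \<in> free_on S"
  shows "(a - b :: _ \<Rightarrow> 'r::comm_ring) \<in> free_on S"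
  using free_on_add[of a S "- b"] assms by simp

lemma free_on_scale:
  assumes "a \<in> free_on S"
  shows "scale r a \<in> free_on S"
proof -
  have "{p. scale r a p \<noteq> 0} \<subseteq> {p. a p \<noteq> 0}" by (auto simp: scale_def)
  from this finite_subset[OF this] show ?thesis
    using assms unfolding free_on_def by blast
qed

section \<open>Isomorphisms of complexes\<close>

lemma lin_map_inv_into:
  assumes M: "module R M" and h: "lin_map R M M' h" and bij: "bij_betw h (carrier M) (carrier M')"
  shows "lin_map R M' M (inv_into (carrier M) h)"
proof -
  interpret module R M by fact
  have surj: "carrier M' = h ` carrier M" and inj: "inj_on h (carrier M)"
    using bij by (auto simp: bij_betw_def)
  have "h x \<oplus>\<^bsub>M'\<^esub> h y = h (x \<oplus>\<^bsub>M\<^esub> y)" if "x \<in> carrier M" "y \<in> carrier M" for x y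
    using h that by (simp add: lin_map_def)
  moreover have "r \<odot>\<^bsub>M'\<^esub> h x = h (r \<odot>\<^bsub>M\<^esub> x)" if "r \<in> carrier R" "x \<in> carrier M" for r x
    using h that by (simp add: lin_map_def)
  ultimately show ?thesis
    unfolding lin_map_def surj by (auto simp: inj)
qed

text \<open>A deformation retract with zero homotopy, the inverse of \<open>j\<close> being the
  retraction. \<open>j\<close> runs from \<open>Y\<close> to \<open>X\<close> because in the
  application this direction, from components to cosets, has an explicit formula.\<close>

lemma quasi_isomorphic_iso:
  assumes X: "chain_complex R X" and Y: "chain_complex R Y" and j: "chain_map R Y X j"
    and bij: "\<And>k. bij_betw (j k) (carrier (chain Y k)) (carrier (chain X k))"
  shows "quasi_isomorphic R X Y"
proof (rule quasi_isomorphic_deformation_retract[OF X Y _ j])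
  let ?p = "\<lambda>k. inv_into (carrier (chain Y k)) (j k)"
  have surj: "carrier (chain X k) = j k ` carrier (chain Y k)" for k
    using bij[of k] by (simp add: bij_betw_def)
  show pj: "?p k (j k y) = y" if "y \<in> carrier (chain Y k)" for k y
    using bij[of k] that by (simp add: bij_betw_def)
  show "chain_map R X Y ?p"
    unfolding chain_map_def
  proof (intro conjI allI ballI)
    show "lin_map R (chain X k) (chain Y k) (?p k)" for k
      by (rule lin_map_inv_into[OF chain_complexD(1)[OF Y] chain_mapD(1)[OF j] bij])
    fix k x assume "x \<in> carrier (chain X k)"
    then obtain y where y: "y \<in> carrier (chain Y k)" "x = j k y" unfolding surj by blast
    then show "?p (k - 1) (bdry X k x) = bdry Y k (?p k x)"
      using chain_mapD(3)[OF j y(1)] chain_complexD(3)[OF Y y(1)] by (metis pj)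
  qed
  \<comment> \<open>The zero map is taken for the homotopy \<open>H\<close>.\<close>
  show "\<zero>\<^bsub>chain X (k + 1)\<^esub> \<in> carrier (chain X (k + 1))" for k
  proof -
    interpret module R "chain X (k + 1)" by (rule chain_complexD(1)[OF X])
    show ?thesis by simp
  qed
  fix k x assume "x \<in> cycles X k"
  then have x: "x \<in> carrier (chain X k)" by (simp add: cycles_def)
  interpret module R "chain X k" by (rule chain_complexD(1)[OF X])
  have "bdry X (k + 1) \<zero>\<^bsub>chain X (k + 1)\<^esub> = \<zero>\<^bsub>chain X k\<^esub>"
    using lin_map_zero[OF chain_complexD(1,1,2)[OF X], of "k + 1"] by simp
  then show "x = bdry X (k + 1) \<zero>\<^bsub>chain X (k + 1)\<^esub> \<oplus>\<^bsub>chain X k\<^esub> j k (?p k x)"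
    using x by (simp add: surj f_inv_into_f)
qed

section \<open>The chain groups and counting maps of the manifold\<close>

lemma scale_distribs:
  "scale r (a + b) = scale r a + scale r b"
  "scale r (a - b) = scale r a - scale r b"
  "scale r (- a) = - scale r a"
  "scale r 0 = 0"
  by (simp_all add: scale_def fun_eq_iff algebra_simps)

context
  fixes A :: "('m::t2_space, 'e::real_normed_vector) chart set"
    and N :: "'m set"
    and f :: "'m \<Rightarrow> real"
    and g :: "'m \<Rightarrow> 'e \<Rightarrow> 'e \<Rightarrow> real"
    and \<omega> :: "'m \<Rightarrow> 'e list \<Rightarrow> real"
    \<comment> \<open>\<open>R\<close> only serves to fix the coefficient type.\<close>
    and R :: "'r::{comm_ring, comm_monoid_mult} ring"
begin

private abbreviation (input) "doo \<equiv> (d_o_o A N f g \<omega> :: ('m \<Rightarrow> 'r) \<Rightarrow> 'm \<Rightarrow> 'r)"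
private abbreviation (input) "dos \<equiv> (d_o_s A N f g \<omega> :: ('m \<Rightarrow> 'r) \<Rightarrow> 'm \<Rightarrow> 'r)"
private abbreviation (input) "duo \<equiv> (d_u_o A N f g \<omega> :: ('m \<Rightarrow> 'r) \<Rightarrow> 'm \<Rightarrow> 'r)"
private abbreviation (input) "dus \<equiv> (d_u_s A N f g \<omega> :: ('m \<Rightarrow> 'r) \<Rightarrow> 'm \<Rightarrow> 'r)"
private abbreviation (input) "bss \<equiv> (b_s_s A N f g \<omega> :: ('m \<Rightarrow> 'r) \<Rightarrow> 'm \<Rightarrow> 'r)"
private abbreviation (input) "bsu \<equiv> (b_s_u A N f g \<omega> :: ('m \<Rightarrow> 'r) \<Rightarrow> 'm \<Rightarrow> 'r)"
private abbreviation (input) "bus \<equiv> (b_u_s A N f g \<omega> :: ('m \<Rightarrow> 'r) \<Rightarrow> 'm \<Rightarrow> 'r)"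
private abbreviation (input) "buu \<equiv> (b_u_u A N f g \<omega> :: ('m \<Rightarrow> 'r) \<Rightarrow> 'm \<Rightarrow> 'r)"
private abbreviation (input) "Co \<equiv> (C_o A N f :: int \<Rightarrow> ('m \<Rightarrow> 'r) set)"
private abbreviation (input) "Cs \<equiv> (C_s A N f g :: int \<Rightarrow> ('m \<Rightarrow> 'r) set)"
private abbreviation (input) "Cu \<equiv> (C_u A N f g :: int \<Rightarrow> ('m \<Rightarrow> 'r) set)"
private abbreviation (input) "Dc \<equiv> (D_check A N f g \<omega> :: ('r, _) chain_cx)"
private abbreviation (input) "Kc \<equiv> (KM_check A N f g \<omega> :: ('r, _) chain_cx)"
private abbreviation (input) "Kh \<equiv> (KM_hat A N f g \<omega> :: ('r, _) chain_cx)"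
private abbreviation (input) "Dh \<equiv> (D_hat A N f g \<omega> :: ('r, _) chain_cx)"

text \<open>With degree \<open>k\<close> of C^u[-1] written as \<open>Cu (k + 1)\<close>, the entry
  \<open>Pi_minus\<close> from degree \<open>k\<close> to degree \<open>k - 1\<close> is the
  identity of \<open>Cu k\<close>.\<close>

lemma C_u_shift_eq: "C_u_shift A N f g k = Cu (k + 1)"
  by (simp add: C_u_shift_def C_u_def diff_eq_eq)

lemma chain_simps:
  "chain Dc k = module4 (Co k \<times> Cs k \<times> Cu (k + 1) \<times> Cu k)"
  "chain Kc k = module2 (Co k \<times> Cs k)"
  "chain Kh k = module2 (Co k \<times> Cu k)"
  by (simp_all add: D_check_def KM_check_def KM_hat_def C_u_shift_eq)

lemma bdry_simps:
  "bdry Dc k (a, b, c, e) =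
    (doo a + duo e, dos a + bss b + bus c + dus e, bsu b + buu c + e,
     - bsu (dos a) + (- buu e - bsu (dus e)))"
  "bdry Kc k (a, b) = (doo a - duo (bsu b), dos a + (bss b - dus (bsu b)))"
  "bdry Kh k (a, e) = (doo a + duo e, - bsu (dos a) + (- buu e - bsu (dus e)))"
  by (simp_all add: D_check_def KM_check_def KM_hat_def Pi_minus_def)

lemma module_simps:
  "carrier (module2 C) = C" "\<zero>\<^bsub>module2 C\<^esub> = 0" "x \<oplus>\<^bsub>module2 C\<^esub> y = x + y"
  "r \<odot>\<^bsub>module2 C\<^esub> (a, b) = (scale r a, scale r b)"
  "carrier (module4 D) = D" "\<zero>\<^bsub>module4 D\<^esub> = 0" "x' \<oplus>\<^bsub>module4 D\<^esub> y' = x' + y'"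
  "r \<odot>\<^bsub>module4 D\<^esub> (a, b, c, e) = (scale r a, scale r b, scale r c, scale r e)"
  by (simp_all add: module2_def module4_def)

lemma chain_groups_closed [simp]:
  "0 \<in> Co k" "0 \<in> Cs k" "0 \<in> Cu k"
  "- x \<in> Co k \<longleftrightarrow> x \<in> Co k" "- x \<in> Cs k \<longleftrightarrow> x \<in> Cs k" "- x \<in> Cu k \<longleftrightarrow> x \<in> Cu k"
  "x \<in> Co k \<Longrightarrow> y \<in> Co k \<Longrightarrow> x + y \<in> Co k" "x \<in> Cs k \<Longrightarrow> y \<in> Cs k \<Longrightarrow> x + y \<in> Cs k"
  "x \<in> Cu k \<Longrightarrow> y \<in> Cu k \<Longrightarrow> x + y \<in> Cu k"
  "x \<in> Co k \<Longrightarrow> y \<in> Co k \<Longrightarrow> x - y \<in> Co k" "x \<in> Cs k \<Longrightarrow> y \<in> Cs k \<Longrightarrow> x - y \<in> Cs k"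
  "x \<in> Cu k \<Longrightarrow> y \<in> Cu k \<Longrightarrow> x - y \<in> Cu k"
  "x \<in> Co k \<Longrightarrow> scale r x \<in> Co k" "x \<in> Cs k \<Longrightarrow> scale r x \<in> Cs k" "x \<in> Cu k \<Longrightarrow> scale r x \<in> Cu k"
  by (simp_all add: C_o_def C_s_def C_u_def free_on_add free_on_diff free_on_scale)

lemma chain_groups_finite:
  "x \<in> Co k \<Longrightarrow> finite {p. x p \<noteq> 0}" "x \<in> Cs k \<Longrightarrow> finite {p. x p \<noteq> 0}"
  "x \<in> Cu k \<Longrightarrow> finite {p. x p \<noteq> 0}"
  by (simp_all add: C_o_def C_s_def C_u_def free_on_def)

lemmas count_maps = d_o_o_def d_o_s_def d_u_o_def d_u_s_def b_s_s_def b_s_u_def b_u_s_def b_u_u_def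

lemma count_maps_0 [simp]:
  "doo 0 = 0" "dos 0 = 0" "duo 0 = 0" "dus 0 = 0" "bss 0 = 0" "bsu 0 = 0" "bus 0 = 0" "buu 0 = 0"
  by (simp_all add: count_maps)

lemma count_maps_uminus [simp]:
  "duo (- x) = - duo x" "dus (- x) = - dus x" "bsu (- x) = - bsu x" "buu (- x) = - buu x"
  by (simp_all add: count_maps lin_ext_uminus)

lemma count_maps_add:
  assumes "finite {p. x p \<noteq> 0}" "finite {p. y p \<noteq> 0}"
  shows "doo (x + y) = doo x + doo y" "dos (x + y) = dos x + dos y"
    "duo (x + y) = duo x + duo y" "dus (x + y) = dus x + dus y"
    "bss (x + y) = bss x + bss y" "bsu (x + y) = bsu x + bsu y"
    "bus (x + y) = bus x + bus y" "buu (x + y) = buu x + buu y"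
  using assms by (simp_all add: count_maps lin_ext_add)

lemma count_maps_diff:
  assumes "finite {p. x p \<noteq> 0}" "finite {p. y p \<noteq> 0}"
  shows "doo (x - y) = doo x - doo y" "dos (x - y) = dos x - dos y"
    "duo (x - y) = duo x - duo y" "dus (x - y) = dus x - dus y"
    "bss (x - y) = bss x - bss y" "bsu (x - y) = bsu x - bsu y"
    "bus (x - y) = bus x - bus y" "buu (x - y) = buu x - buu y"
  using assms by (simp_all add: count_maps lin_ext_diff)

lemma count_maps_scale:
  assumes "finite {p. x p \<noteq> 0}"
  shows "duo (scale r x) = scale r (duo x)" "dus (scale r x) = scale r (dus x)"
    "bsu (scale r x) = scale r (bsu x)"
  using assms by (simp_all add: count_maps lin_ext_scale)

section \<open>Cosets of the boundary subcomplex\<close>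

text \<open>The coset of \<open>C_bar\<close> through \<open>(a, 0, 0, e)\<close>, given as a
  product so that membership and equality are decided componentwise.\<close>

definition hat_coset :: "int \<Rightarrow> ('m \<Rightarrow> 'r) \<times> ('m \<Rightarrow> 'r) \<Rightarrow>
    (('m \<Rightarrow> 'r) \<times> ('m \<Rightarrow> 'r) \<times> ('m \<Rightarrow> 'r) \<times> ('m \<Rightarrow> 'r)) set" where
  "hat_coset k = (\<lambda>(a, e). {a} \<times> Cs k \<times> Cu (k + 1) \<times> {e})"

lemma coset_eq_hat_coset:
  assumes "b \<in> Cs k" "c \<in> Cu (k + 1)"
  shows "carrier (chain (C_bar A N f g \<omega>) k) +>\<^bsub>chain Dc k\<^esub> (a, b, c, e) = hat_coset k (a, e)"
proof -
  have "(a', b', c', e') \<in> carrier (chain (C_bar A N f g \<omega>) k) +>\<^bsub>chain Dc k\<^esub> (a, b, c, e) \<longleftrightarrow>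
      (a', b', c', e') \<in> hat_coset k (a, e)" for a' b' c' e'
  proof
    assume "(a', b', c', e') \<in> hat_coset k (a, e)"
    with assms have "b' - b \<in> Cs k" "c' - c \<in> Cu (k + 1)" "a' = a" "e' = e"
      by (auto simp: hat_coset_def)
    then show "(a', b', c', e') \<in> carrier (chain (C_bar A N f g \<omega>) k) +>\<^bsub>chain Dc k\<^esub> (a, b, c, e)"
      by (simp add: a_r_coset_def' C_bar_def C_u_shift_eq chain_simps module_simps)
        (metis diff_add_cancel)
  qed (use assms in \<open>auto simp: a_r_coset_def' C_bar_def C_u_shift_eq chain_simps module_simps hat_coset_def\<close>)
  then show ?thesis by auto
qed

text \<open>Scalar multiplication and differential of a quotient are unions over representatives;
  this evaluates them once independence of the representative is known. The element
  \<open>(a, 0, 0, e)\<close> keeps the union from being empty.\<close>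

lemma UN_hat_coset:
  assumes "\<And>b c. b \<in> Cs k \<Longrightarrow> c \<in> Cu (k + 1) \<Longrightarrow> F (a, b, c, e) = T"
  shows "(\<Union>x\<in>hat_coset k (a, e). F x) = T"
proof -
  have "(a, 0, 0, e) \<in> hat_coset k (a, e)" by (simp add: hat_coset_def)
  moreover have "F x = T" if "x \<in> hat_coset k (a, e)" for x
    using that assms by (auto simp: hat_coset_def)
  ultimately show ?thesis by auto
qed

lemma hat_coset_add:
  "hat_coset k x <+>\<^bsub>chain Dc k\<^esub> hat_coset k y = hat_coset k (x + y)"
proof -
  obtain a e a' e' where xy: "x = (a, e)" "y = (a', e')" by (metis prod.exhaust)
  have "z \<in> hat_coset k x <+>\<^bsub>chain Dc k\<^esub> hat_coset k y" if z: "z \<in> hat_coset k (x + y)" for z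
  proof -
    \<comment> \<open>The first summand takes the middle components entirely.\<close>
    obtain b c where "z = (a, b, c, e) + (a', 0, 0, e')" "(a, b, c, e) \<in> hat_coset k x"
      using z by (auto simp: xy hat_coset_def)
    moreover have "(a', 0, 0, e') \<in> hat_coset k y"
      by (simp add: xy hat_coset_def)
    ultimately show ?thesis
      unfolding set_add_def' chain_simps module_simps by blast
  qed
  moreover have "hat_coset k x <+>\<^bsub>chain Dc k\<^esub> hat_coset k y \<subseteq> hat_coset k (x + y)"
    by (auto simp: set_add_def' xy hat_coset_def chain_simps module_simps)
  ultimately show ?thesis by blast
qed

section \<open>Relations contained in the large complex\<close>

context
  assumes complex: "chain_complex type_ring Dc"
begin

lemma D_check_closed:
  assumes "a \<in> Co k" "b \<in> Cs k" "c \<in> Cu (k + 1)" "e \<in> Cu k"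
  shows "bdry Dc k (a, b, c, e) \<in> Co (k - 1) \<times> Cs (k - 1) \<times> Cu k \<times> Cu (k - 1)"
  using chain_complexD(3)[OF complex, of "(a, b, c, e)" k] assms
  by (simp add: chain_simps module_simps)

lemma D_check_square:
  assumes "a \<in> Co k" "b \<in> Cs k" "c \<in> Cu (k + 1)" "e \<in> Cu k"
  shows "bdry Dc (k - 1) (bdry Dc k (a, b, c, e)) = 0"
  using chain_complexD(4)[OF complex, of "(a, b, c, e)" k] assms
  by (simp add: chain_simps module_simps)

text \<open>Evaluating the large differential on a vector with a single nonzero component isolates
  one column of the matrix, whose entries must then land in the right degrees.\<close>

lemma count_maps_closed:
  "a \<in> Co k \<Longrightarrow> doo a \<in> Co (k - 1)" "a \<in> Co k \<Longrightarrow> dos a \<in> Cs (k - 1)"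
  "b \<in> Cs k \<Longrightarrow> bss b \<in> Cs (k - 1)" "b \<in> Cs k \<Longrightarrow> bsu b \<in> Cu k"
  "c \<in> Cu (k + 1) \<Longrightarrow> bus c \<in> Cs (k - 1)" "c \<in> Cu (k + 1) \<Longrightarrow> buu c \<in> Cu k"
  "e \<in> Cu k \<Longrightarrow> duo e \<in> Co (k - 1)" "e \<in> Cu k \<Longrightarrow> dus e \<in> Cs (k - 1)"
  using D_check_closed[of a k 0 0 0] D_check_closed[of 0 k b 0 0] D_check_closed[of 0 k 0 c 0] D_check_closed[of 0 k 0 0 e]
  by (auto simp: bdry_simps)

text \<open>The entry of the squared differential from C^s to C^u[-1].\<close>

lemma bsu_bss: "b \<in> Cs k \<Longrightarrow> bsu (bss b) = - buu (bsu b)"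
  using D_check_square[of 0 k b 0 0] by (simp add: bdry_simps zero_prod_def eq_neg_iff_add_eq_0)

text \<open>The entry of the squared differential from C^u_- to C^o, solved for the term with
  \<open>buu\<close>.\<close>

lemma duo_buu:
  assumes e: "e \<in> Cu k"
  shows "duo (buu e) = doo (duo e) - duo (bsu (dus e))"
proof -
  \<comment> \<open>\<open>count_maps_closed(6)\<close> concerns the shifted summand, hence its use
    in degree \<open>k - 1\<close>. Finiteness lets \<open>duo\<close> split over the
    difference.\<close>
  have fin: "finite {p. buu e p \<noteq> 0}" "finite {p. bsu (dus e) p \<noteq> 0}"
    using count_maps_closed(6)[of e "k - 1"] count_maps_closed(4)[OF count_maps_closed(8)[OF e]] e
    by (auto intro: chain_groups_finite)
  then show ?thesis
    using D_check_square[of 0 k 0 0 e] e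
    by (simp add: bdry_simps zero_prod_def count_maps_diff[of "- buu e"] algebra_simps eq_neg_iff_add_eq_0)
qed

text \<open>The entry from C^u_- to C^s; the term \<open>bus e\<close> arises by passing through
  \<open>Pi_minus\<close>.\<close>

lemma dus_buu:
  assumes e: "e \<in> Cu k"
  shows "dus (buu e) = dos (duo e) + bss (dus e) + bus e - dus (bsu (dus e))"
proof -
  have fin: "finite {p. buu e p \<noteq> 0}" "finite {p. bsu (dus e) p \<noteq> 0}"
    using count_maps_closed(6)[of e "k - 1"] count_maps_closed(4)[OF count_maps_closed(8)[OF e]] e
    by (auto intro: chain_groups_finite)
  then show ?thesis
    using D_check_square[of 0 k 0 0 e] e
    by (simp add: bdry_simps zero_prod_def count_maps_diff[of "- buu e"] algebra_simps eq_neg_iff_add_eq_0)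
qed

section \<open>The first quasi-isomorphism\<close>

text \<open>The differential sends \<open>e\<close> to \<open>duo e\<close>, \<open>dus e\<close>
  and \<open>e\<close> in the first three components, so \<open>p\<close> cancels its contribution.
  The terms in \<open>c\<close> agree by \<open>duo_buu\<close> and \<open>dus_buu\<close>. As
  \<open>p\<close> is onto, the target inherits the structure of a complex.\<close>

lemma KM_check_retraction:
  defines "p \<equiv> \<lambda>k::int. \<lambda>(a, b, c, e). (a - duo c, b - dus c)"
  shows "chain_complex type_ring Kc" and "chain_map type_ring Dc Kc p"
proof -
  have lin: "lin_map type_ring (chain Dc k) (chain Kc k) (p k)" for k
    using count_maps_closed(7,8)[of _ "k + 1"]
    by (auto simp: lin_map_def chain_simps module_simps p_def count_maps_add[OF chain_groups_finite(3) chain_groups_finite(3)]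
        count_maps_scale[OF chain_groups_finite(3)] scale_distribs algebra_simps)
  have comm: "p (k - 1) (bdry Dc k x) = bdry Kc k (p k x)" if "x \<in> carrier (chain Dc k)" for k x
  proof -
    obtain a b c e where x: "x = (a, b, c, e)" and mem: "a \<in> Co k" "b \<in> Cs k" "c \<in> Cu (k + 1)" "e \<in> Cu k"
      using \<open>x \<in> _\<close> by (cases x) (auto simp: chain_simps module_simps)
    have fin: "finite {p. duo c p \<noteq> 0}" "finite {p. dus c p \<noteq> 0}" "finite {p. bsu b p \<noteq> 0}"
      "finite {p. bsu (dus c) p \<noteq> 0}" "finite {p. buu c p \<noteq> 0}"
      using mem count_maps_closed(7,8)[OF mem(3)] count_maps_closed(4)[OF mem(2)] count_maps_closed(6)[OF mem(3)]
        count_maps_closed(4)[of "dus c" k]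
      by (auto intro: chain_groups_finite)
    moreover have "bsu b + buu c \<in> Cu k"
      using mem by (simp add: count_maps_closed)
    note chain_groups_finite(3)[OF this]
    ultimately show ?thesis
      using mem duo_buu[OF mem(3)] dus_buu[OF mem(3)]
      by (simp add: x p_def bdry_simps count_maps_add count_maps_diff chain_groups_finite algebra_simps)
  qed
  have surj: "p k ` carrier (chain Dc k) = carrier (chain Kc k)" for k
  proof
    show "p k ` carrier (chain Dc k) \<subseteq> carrier (chain Kc k)"
      using lin[of k] by (auto simp: lin_map_def)
    show "carrier (chain Kc k) \<subseteq> p k ` carrier (chain Dc k)"
    proof clarify
      fix a b assume "(a, b) \<in> carrier (chain Kc k)"
      then show "(a, b) \<in> p k ` carrier (chain Dc k)"
        \<comment> \<open>Any preimage will do for surjectivity; the section by a chain map has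
          \<open>- bsu b\<close> in the last place.\<close>
        by (intro image_eqI[of _ _ "(a, b, 0, 0)"]) (simp_all add: p_def chain_simps module_simps)
    qed
  qed
  show "chain_complex type_ring Kc"
    by (rule chain_complex_surj_image[OF complex lin surj _ comm])
      (simp_all add: chain_simps module_simps p_def zero_prod_def)
  show "chain_map type_ring Dc Kc p"
    using lin comm by (simp add: chain_map_def)
qed

text \<open>The entry \<open>- bsu b\<close> is forced by the third component of the differential,
  which has to vanish. The fourth components then agree by \<open>bsu_bss\<close>.\<close>

lemma KM_check_inclusion:
  "chain_map type_ring Kc Dc (\<lambda>k (a, b). (a, b, 0, - bsu b))"
  unfolding chain_map_def
proof (intro conjI allI ballI)
  show "lin_map type_ring (chain Kc k) (chain Dc k) (\<lambda>(a, b). (a, b, 0, - bsu b))" for k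
    by (auto simp: lin_map_def chain_simps module_simps count_maps_closed count_maps_add[OF chain_groups_finite(2) chain_groups_finite(2)]
        count_maps_scale[OF chain_groups_finite(2)] scale_distribs)
  fix k x assume "x \<in> carrier (chain Kc k)"
  then obtain a b where x: "x = (a, b)" and mem: "a \<in> Co k" "b \<in> Cs k"
    by (cases x) (auto simp: chain_simps module_simps)
  have dus: "dus (bsu b) \<in> Cs (k - 1)"
    using count_maps_closed(8)[OF count_maps_closed(4)[OF mem(2)]] .
  have fin: "finite {p. dos a p \<noteq> 0}" "finite {p. bss b p \<noteq> 0}" "finite {p. dus (bsu b) p \<noteq> 0}"
    using mem dus count_maps_closed(2)[OF mem(1)] count_maps_closed(3)[OF mem(2)]
    by (auto intro: chain_groups_finite)
  moreover have "bss b - dus (bsu b) \<in> Cs (k - 1)"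
    using mem dus by (simp add: count_maps_closed)
  note chain_groups_finite(2)[OF this]
  ultimately show "(\<lambda>(a, b). (a, b, 0, - bsu b)) (bdry Kc k x) = bdry Dc k ((\<lambda>(a, b). (a, b, 0, - bsu b)) x)"
    using bsu_bss[OF mem(2)]
    by (simp add: x bdry_simps count_maps_add count_maps_diff)
qed

lemma check_quasi_isomorphic: "quasi_isomorphic type_ring Dc Kc"
proof (rule quasi_isomorphic_deformation_retract[OF complex KM_check_retraction KM_check_inclusion])
  \<comment> \<open>The degrees fit in \<open>?H\<close>: \<open>c\<close> lies in
    \<open>Cu (k + 1)\<close>, which is C^u_- in degree \<open>k + 1\<close>.\<close>
  let ?p = "\<lambda>(a, b, c, e). (a - duo c, b - dus c)" and ?i = "\<lambda>(a, b). (a, b, 0, - bsu b)"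
    and ?H = "\<lambda>(a, b, c, e). (0, 0, 0, c)"
  show "?p (?i y) = y" for y by (cases y) simp
  show "?H x \<in> carrier (chain Dc (k + 1))" if "x \<in> carrier (chain Dc k)" for k x
    using that by (auto simp: chain_simps module_simps)
  fix k x assume "x \<in> cycles Dc k"
  then obtain a b c e where x: "x = (a, b, c, e)"
    and mem: "a \<in> Co k" "b \<in> Cs k" "c \<in> Cu (k + 1)" "e \<in> Cu k" and cycle: "bdry Dc k (a, b, c, e) = 0"
    by (cases x) (auto simp: cycles_def chain_simps module_simps)
  have "finite {p. b p \<noteq> 0}" "finite {p. dus c p \<noteq> 0}"
    using mem count_maps_closed(8)[OF mem(3)] by (auto intro: chain_groups_finite)
  \<comment> \<open>The first three components agree identically. The fourth uses the cycle
    condition, whose third component gives \<open>e = - bsu b - buu c\<close>.\<close>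
  then show "x = bdry Dc (k + 1) (?H x) \<oplus>\<^bsub>chain Dc k\<^esub> ?i (?p x)"
    using cycle by (simp add: x bdry_simps chain_simps module_simps zero_prod_def count_maps_diff
        algebra_simps eq_neg_iff_add_eq_0)
qed

section \<open>The second quasi-isomorphism\<close>

text \<open>The first and last rows of the large differential involve only \<open>a\<close> and
  \<open>e\<close>, so projecting to these components commutes with the differentials.\<close>

lemma KM_hat_complex: "chain_complex type_ring Kh"
proof (rule chain_complex_surj_image[OF complex, of _ "\<lambda>k (a, b, c, e). (a, e)"])
  show "(\<lambda>(a, b, c, e). (a, e)) ` carrier (chain Dc k) = carrier (chain Kh k)" for k
  proof
    show "carrier (chain Kh k) \<subseteq> (\<lambda>(a, b, c, e). (a, e)) ` carrier (chain Dc k)"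
    proof clarify
      fix a e assume "(a, e) \<in> carrier (chain Kh k)"
      then show "(a, e) \<in> (\<lambda>(a, b, c, e). (a, e)) ` carrier (chain Dc k)"
        by (intro image_eqI[of _ _ "(a, 0, 0, e)"]) (simp_all add: chain_simps module_simps)
    qed
  qed (auto simp: chain_simps module_simps)
qed (auto simp: lin_map_def chain_simps module_simps bdry_simps zero_prod_def)

lemma hat_chain_map:
  shows "\<And>k. hat_coset k ` carrier (chain Kh k) = carrier (chain Dh k)"
    and "\<And>k. lin_map type_ring (chain Kh k) (chain Dh k) (hat_coset k)"
    and "\<And>k x. x \<in> carrier (chain Kh k) \<Longrightarrow> hat_coset (k - 1) (bdry Kh k x) = bdry Dh k (hat_coset k x)"
    and "\<And>k. hat_coset k \<zero>\<^bsub>chain Kh k\<^esub> = \<zero>\<^bsub>chain Dh k\<^esub>"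
proof -
  show surj: "hat_coset k ` carrier (chain Kh k) = carrier (chain Dh k)" for k
  proof -
    have Dh: "carrier (chain Dh k) =
        (\<lambda>x. carrier (chain (C_bar A N f g \<omega>) k) +>\<^bsub>chain Dc k\<^esub> x) ` carrier (chain Dc k)"
      by (auto simp: D_hat_def quotient_complex_def quotient_module_def A_RCOSETS_def')
    show ?thesis
    proof
      show "hat_coset k ` carrier (chain Kh k) \<subseteq> carrier (chain Dh k)"
      proof clarify
        fix a e assume "(a, e) \<in> carrier (chain Kh k)"
        then show "hat_coset k (a, e) \<in> carrier (chain Dh k)"
          unfolding Dh using coset_eq_hat_coset[of 0 k 0 a e, symmetric]
          by (intro image_eqI[of _ _ "(a, 0, 0, e)"]) (simp_all add: chain_simps module_simps)
      qed
      show "carrier (chain Dh k) \<subseteq> hat_coset k ` carrier (chain Kh k)"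
      proof
        fix H assume "H \<in> carrier (chain Dh k)"
        then obtain a b c e where "H = carrier (chain (C_bar A N f g \<omega>) k) +>\<^bsub>chain Dc k\<^esub> (a, b, c, e)"
          "a \<in> Co k" "b \<in> Cs k" "c \<in> Cu (k + 1)" "e \<in> Cu k"
          unfolding Dh by (auto simp: chain_simps module_simps)
        then show "H \<in> hat_coset k ` carrier (chain Kh k)"
          by (auto simp: coset_eq_hat_coset chain_simps(3) module_simps)
      qed
    qed
  qed
  show "lin_map type_ring (chain Kh k) (chain Dh k) (hat_coset k)" for k
    unfolding lin_map_def
  proof (intro conjI ballI)
    show "hat_coset k \<in> carrier (chain Kh k) \<rightarrow> carrier (chain Dh k)"
      using surj[of k] by blast
    show "hat_coset k (x \<oplus>\<^bsub>chain Kh k\<^esub> y) = hat_coset k x \<oplus>\<^bsub>chain Dh k\<^esub> hat_coset k y" for x y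
      by (simp add: D_hat_def quotient_complex_def quotient_module_def hat_coset_add chain_simps(3) module_simps)
    fix r :: 'r and x :: "('m \<Rightarrow> 'r) \<times> ('m \<Rightarrow> 'r)"
    obtain a e where x: "x = (a, e)" by (metis prod.exhaust)
    have smult: "r \<odot>\<^bsub>chain Dc k\<^esub> (a, b, c, e) = (scale r a, scale r b, scale r c, scale r e)" for b c
      by (simp add: chain_simps module_simps)
    have "r \<odot>\<^bsub>chain Dh k\<^esub> hat_coset k (a, e) = hat_coset k (scale r a, scale r e)"
      unfolding D_hat_def quotient_complex_def quotient_module_def
      by (simp, rule UN_hat_coset) (simp add: smult coset_eq_hat_coset)
    then show "hat_coset k (r \<odot>\<^bsub>chain Kh k\<^esub> x) = r \<odot>\<^bsub>chain Dh k\<^esub> hat_coset k x"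
      by (simp add: x chain_simps(3) module_simps)
  qed
  show "hat_coset (k - 1) (bdry Kh k x) = bdry Dh k (hat_coset k x)" if "x \<in> carrier (chain Kh k)" for k x
  proof -
    obtain a e where x: "x = (a, e)" and mem: "a \<in> Co k" "e \<in> Cu k"
      using \<open>x \<in> _\<close> by (cases x) (auto simp: chain_simps module_simps)
    \<comment> \<open>The middle components of the image depend on \<open>b\<close> and
      \<open>c\<close> but stay in the groups of \<open>C_bar\<close>, so the coset does not see
      them.\<close>
    have "carrier (chain (C_bar A N f g \<omega>) (k - 1)) +>\<^bsub>chain Dc (k - 1)\<^esub> bdry Dc k (a, b, c, e) =
        hat_coset (k - 1) (bdry Kh k (a, e))" if "b \<in> Cs k" "c \<in> Cu (k + 1)" for b c
      using D_check_closed[OF mem(1) that mem(2)] by (simp add: bdry_simps coset_eq_hat_coset)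
    then show ?thesis
      unfolding x D_hat_def quotient_complex_def by (simp add: UN_hat_coset)
  qed
  \<comment> \<open>The zero of the quotient is the carrier of \<open>C_bar\<close> itself.\<close>
  show "hat_coset k \<zero>\<^bsub>chain Kh k\<^esub> = \<zero>\<^bsub>chain Dh k\<^esub>" for k
    by (simp add: D_hat_def quotient_complex_def quotient_module_def C_bar_def C_u_shift_eq
        hat_coset_def chain_simps module_simps zero_prod_def)
qed

lemma hat_quasi_isomorphic: "quasi_isomorphic type_ring Dh Kh"
proof (rule quasi_isomorphic_iso[OF _ KM_hat_complex, of _ hat_coset])
  show "chain_complex type_ring Dh"
    by (rule chain_complex_surj_image[OF KM_hat_complex hat_chain_map(2,1,4,3)])
  show "chain_map type_ring Kh Dh hat_coset"
    using hat_chain_map(2,3) by (simp add: chain_map_def)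
  \<comment> \<open>The outer factors of the product are singletons, and a representative with zero
    middle components exhibits them.\<close>
  have "inj_on (hat_coset k) C" for k C
  proof (rule inj_onI)
    fix x y assume "hat_coset k x = hat_coset k y"
    moreover have "(fst x, 0, 0, snd x) \<in> hat_coset k x" by (simp add: hat_coset_def case_prod_beta)
    ultimately show "x = y" by (auto simp: hat_coset_def case_prod_beta prod_eq_iff)
  qed
  then show "bij_betw (hat_coset k) (carrier (chain Kh k)) (carrier (chain Dh k))" for k
    by (simp add: bij_betw_def hat_chain_map(1))
qed

end

end

theorem proposition3p5:
  fixes A :: "('m::t2_space, 'e::real_normed_vector) chart set"
    and N :: "'m set"
    and \<phi> :: "'m \<Rightarrow> 'm"
    and f :: "'m \<Rightarrow> real"
    and g :: "'m \<Rightarrow> 'e \<Rightarrow> 'e \<Rightarrow> real"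
    and \<omega> :: "'m \<Rightarrow> 'e list \<Rightarrow> real"
  assumes "closed_manifold A" and "smooth_double A N \<phi>"
    and "morse_function A f" and "invariant_fun {id, \<phi>} f"
    and "riemannian_metric A g" and "invariant_metric A {id, \<phi>} g"
    and "stably_morse_smale A {id, \<phi>} f g"
    and "orientation_choice A N f g \<omega>"
    and "chain_complex (type_ring :: 'r::{comm_ring, comm_monoid_mult} ring) (D_check A N f g \<omega>)"
  shows "quasi_isomorphic (type_ring :: 'r ring) (D_check A N f g \<omega>) (KM_check A N f g \<omega>) \<and>
         quasi_isomorphic (type_ring :: 'r ring) (D_hat A N f g \<omega>) (KM_hat A N f g \<omega>)"
  using check_quasi_isomorphic[OF assms(9)] hat_quasi_isomorphic[OF assms(9)] by blast

end
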